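(* Let $n>0$ and let $\mathrm{Col}_3(n)$ be the $(3,1)$-polygraph obtained from the column presentation $\mathrm{Col}_2(n)$ by adjoining one $3$-cell $\mathcal{X}_{u,v,t}$ for every triple $(u,v,t)$ of columns in $\mathrm{col}(n)$ such that neither $(u,v)$ nor $(v,t)$ forms a tableau, where $\mathcal{X}_{u,v,t}$ goes from the $2$-cell $$(\alpha_{u,v}c_t)\star_1(c_e\alpha_{e',t})\star_1(\alpha_{e,b}c_{b'}) : c_uc_vc_t\Rightarrow c_ec_{e'}c_t\Rightarrow c_ec_bc_{b'}\Rightarrow c_ac_dc_{b'}$$ to the $2$-cell $$(c_u\alpha_{v,t})\star_1(\alpha_{u,w}c_{w'})\star_1(c_a\alpha_{a',w'}) : c_uc_vc_t\Rightarrow c_uc_wc_{w'}\Rightarrow c_ac_{a'}c_{w'}\Rightarrow c_ac_dc_{b'}.$$ Then $\mathrm{Col}_3(n)$ is a coherent presentation of the plactic monoid $\mathbf{P}_n$.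
   Context: Let $[n]=\{1<2<\dots<n\}$ and $[n]^*$ the free monoid on it. The plactic monoid $\mathbf{P}_n$ is the monoid generated by $[n]$ subject to the Knuth relations $zxy=xzy$ for $1\le x\le y<z\le n$ and $yzx=yxz$ for $1\le x<y\le z\le n$; equivalently $u=v$ in $\mathbf{P}_n$ iff the Schensted tableaux $P(u),P(v)$ coincide. A row is a word $x_1\dots x_k$ with $x_1\le\dots\le x_k$; a column is a word $x_p\dots x_1$ with $x_p>\dots>x_1$; $\mathrm{col}(n)$ is the set of nonempty columns. A row $x_1\dots x_k$ dominates a row $y_1\dots y_l$ if $k\le l$ and $x_i>y_i$ for $i\le k$; a word, decomposed as a product $u_1\dots u_k$ of rows of maximal length, is a tableau if each $u_i$ dominates $u_{i+1}$. The Schensted tableau $P(w)$ is computed by inserting letters one at a time starting from the empty tableau: to insert $y$ into a tableau $u_1\dots u_k$, if $u_ky$ is a row the result is $u_1\dots u_ky$; otherwise, writing $u_k=x_1\dots x_l$ and $j$ minimal with $x_j>y$, the result is $P(u_1\dots u_{k-1}x_j)\,x_1\dots x_{j-1}yx_{j+1}\dots x_l$. In the planar representation (rows stacked, the row $u_k$ on top, left-justified), each column read from bottom to top is an element of $\mathrm{col}(n)$. For columns $u=x_p\dots x_1$, $v=y_q\dots y_1$, the tableau $P(uv)$ has at most two columns; we say $(u,v)$ forms a tableau if $p\ge q$ and $x_i\le y_i$ for all $i\le q$ (i.e. $P(uv)$ has left column $u$ and right column $v$). Write $c_\emptyset$ for the empty word and, for columns $p,q$ (possibly empty), let the left and right columns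 of $P(pq)$ be the columns of $P(pq)$ (the right one empty if $P(pq)$ is a single column). The column presentation $\mathrm{Col}_2(n)$ is the $2$-polygraph (rewriting system) with generators $\mathrm{Col}_1(n)=\{c_u\mid u\in\mathrm{col}(n)\}$ and one $2$-cell $\alpha_{u,v}:c_uc_v\Rightarrow c_wc_{w'}$ for every pair of columns $(u,v)$ not forming a tableau, where $w,w'$ are the left and right columns of $P(uv)$ ($c_{w'}=c_\emptyset$ if $P(uv)$ is a single column). In the definition of $\mathcal{X}_{u,v,t}$: $e,e'$ are the columns of $P(uv)$; $w,w'$ the columns of $P(vt)$; $a,a'$ the columns of $P(uw)$; $b,b'$ the columns of $P(e't)$; $d$ is such that $a,d,b'$ are the columns of $P(uvt)$ (the two displayed $2$-cells are parallel with this common target). Columns may be empty, and whenever $p$ or $q$ is empty or $(p,q)$ forms a tableau, $\alpha_{p,q}$ denotes the identity $2$-cell on $c_pc_q$. A $2$-polygraph $(\Sigma_1,\Sigma_2)$ (generators and oriented relations) presents the monoid $\Sigma_1^*/\!\equiv$ where $\equiv$ is the congruence generated by $\Sigma_2$. A $(3,1)$-polygraph is a $2$-polygraph together with a set $\Sigma_3$ of $3$-cells, each relating two parallel $2$-cells (same source and target words) of the free $(2,1)$-category $\Sigma_2^\top$ generated by the $2$-polygraph (2-cells are composites of rewriting steps in context and their formal inverses). It is a coherent presentation of a monoid $M$ if its underlying $2$-polygraph presents $M$ and for every pair of parallel $2$-cells $f,g$ of $\Sigma_2^\top$ there is a $3$-cell from $f$ to $g$ in the free $(3,1)$-category generated by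 $\Sigma_3$. *)

theory Defs
  imports "HOL-Algebra.Group"
begin

section \<open>Polygraphs presenting monoids\<close>

text \<open>
  All polygraphs have a single \<open>0\<close>-cell, so that \<open>1\<close>-cells of the free category are words
  (lists of generators) and \<open>\<star>\<^sub>0\<close> is concatenation on them.
\<close>

record ('a, 'b) polygraph2 =
  gens1 :: "'a set"
  gens2 :: "'b set"
  src2 :: "'b \<Rightarrow> 'a list"
  tgt2 :: "'b \<Rightarrow> 'a list"

definition polygraph2 :: "('a, 'b, 'z) polygraph2_scheme \<Rightarrow> bool" where
  "polygraph2 S \<longleftrightarrow>
     (\<forall>\<alpha>\<in>gens2 S. src2 S \<alpha> \<in> lists (gens1 S) \<and> tgt2 S \<alpha> \<in> lists (gens1 S))"

inductive polygraph_cong :: "('a, 'b, 'z) polygraph2_scheme \<Rightarrow> 'a list \<Rightarrow> 'a list \<Rightarrow> bool"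
  for S where
  gen: "\<alpha> \<in> gens2 S \<Longrightarrow> polygraph_cong S (src2 S \<alpha>) (tgt2 S \<alpha>)"
| refl: "x \<in> lists (gens1 S) \<Longrightarrow> polygraph_cong S x x"
| sym: "polygraph_cong S x y \<Longrightarrow> polygraph_cong S y x"
| trans: "polygraph_cong S x y \<Longrightarrow> polygraph_cong S y z \<Longrightarrow> polygraph_cong S x z"
| app: "polygraph_cong S x y \<Longrightarrow> polygraph_cong S x' y' \<Longrightarrow> polygraph_cong S (x @ x') (y @ y')"

definition cong_rel :: "('a, 'b, 'z) polygraph2_scheme \<Rightarrow> ('a list \<times> 'a list) set" where
  "cong_rel S = {(x, y). polygraph_cong S x y}"

definition presented_monoid :: "('a, 'b, 'z) polygraph2_scheme \<Rightarrow> 'a list set monoid" where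
  "presented_monoid S =
     \<lparr>carrier = lists (gens1 S) // cong_rel S,
      mult = (\<lambda>X Y. \<Union>x\<in>X. \<Union>y\<in>Y. cong_rel S `` {x @ y}),
      one = cong_rel S `` {[]}\<rparr>"

definition presents :: "('a, 'b, 'z) polygraph2_scheme \<Rightarrow> 'm monoid \<Rightarrow> bool" where
  "presents S M \<longleftrightarrow> polygraph2 S \<and> presented_monoid S \<cong> M"


subsection \<open>The free \<open>(2,1)\<close>-category\<close>

text \<open>
  A \<open>2\<close>-cell of \<open>\<Sigma>\<^sub>2\<^sup>\<top>\<close> is represented by a well-typed expression: \<open>hom2 S f x y\<close> says that \<open>f\<close>
  denotes a \<open>2\<close>-cell \<open>x \<Rightarrow> y\<close>, and \<open>eq2 S f g\<close> that \<open>f\<close> and \<open>g\<close> denote the same \<open>2\<close>-cell, i.e. that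
  they are identified by the axioms of \<open>2\<close>-categories with invertible \<open>2\<close>-cells. Whiskering a
  \<open>2\<close>-cell by a word is \<open>\<star>\<^sub>0\<close>-composition with the identity on that word.
\<close>

datatype ('a, 'b) cell2 =
    Gen2 'b
  | Id2 "'a list"
  | Comp20 "('a, 'b) cell2" "('a, 'b) cell2"  (infixr "\<star>\<^sub>0" 75)
  | Comp21 "('a, 'b) cell2" "('a, 'b) cell2"  (infixr "\<star>\<^sub>1" 70)
  | Inv2 "('a, 'b) cell2"

inductive hom2 :: "('a, 'b, 'z) polygraph2_scheme \<Rightarrow> ('a, 'b) cell2 \<Rightarrow> 'a list \<Rightarrow> 'a list \<Rightarrow> bool"
  for S where
  Gen2: "\<alpha> \<in> gens2 S \<Longrightarrow> hom2 S (Gen2 \<alpha>) (src2 S \<alpha>) (tgt2 S \<alpha>)"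
| Id2: "x \<in> lists (gens1 S) \<Longrightarrow> hom2 S (Id2 x) x x"
| Comp20: "hom2 S f x y \<Longrightarrow> hom2 S f' x' y' \<Longrightarrow> hom2 S (f \<star>\<^sub>0 f') (x @ x') (y @ y')"
| Comp21: "hom2 S f x y \<Longrightarrow> hom2 S g y z \<Longrightarrow> hom2 S (f \<star>\<^sub>1 g) x z"
| Inv2: "hom2 S f x y \<Longrightarrow> hom2 S (Inv2 f) y x"

inductive eq2 :: "('a, 'b, 'z) polygraph2_scheme \<Rightarrow> ('a, 'b) cell2 \<Rightarrow> ('a, 'b) cell2 \<Rightarrow> bool"
  for S where
  refl: "hom2 S f x y \<Longrightarrow> eq2 S f f"
| sym: "eq2 S f g \<Longrightarrow> eq2 S g f"
| trans: "eq2 S f g \<Longrightarrow> eq2 S g h \<Longrightarrow> eq2 S f h"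
| cong0: "eq2 S f f' \<Longrightarrow> eq2 S g g' \<Longrightarrow> eq2 S (f \<star>\<^sub>0 g) (f' \<star>\<^sub>0 g')"
| cong1: "eq2 S f f' \<Longrightarrow> eq2 S g g' \<Longrightarrow> hom2 S f x y \<Longrightarrow> hom2 S g y z \<Longrightarrow>
    eq2 S (f \<star>\<^sub>1 g) (f' \<star>\<^sub>1 g')"
| cong_inv: "eq2 S f f' \<Longrightarrow> eq2 S (Inv2 f) (Inv2 f')"
| assoc1: "hom2 S f x y \<Longrightarrow> hom2 S g y z \<Longrightarrow> hom2 S h z t \<Longrightarrow>
    eq2 S ((f \<star>\<^sub>1 g) \<star>\<^sub>1 h) (f \<star>\<^sub>1 (g \<star>\<^sub>1 h))"
| unit1_left: "hom2 S f x y \<Longrightarrow> eq2 S (Id2 x \<star>\<^sub>1 f) f"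
| unit1_right: "hom2 S f x y \<Longrightarrow> eq2 S (f \<star>\<^sub>1 Id2 y) f"
| inv_right: "hom2 S f x y \<Longrightarrow> eq2 S (f \<star>\<^sub>1 Inv2 f) (Id2 x)"
| inv_left: "hom2 S f x y \<Longrightarrow> eq2 S (Inv2 f \<star>\<^sub>1 f) (Id2 y)"
| assoc0: "hom2 S f x y \<Longrightarrow> hom2 S g x' y' \<Longrightarrow> hom2 S h x'' y'' \<Longrightarrow>
    eq2 S ((f \<star>\<^sub>0 g) \<star>\<^sub>0 h) (f \<star>\<^sub>0 (g \<star>\<^sub>0 h))"
| unit0_left: "hom2 S f x y \<Longrightarrow> eq2 S (Id2 [] \<star>\<^sub>0 f) f"
| unit0_right: "hom2 S f x y \<Longrightarrow> eq2 S (f \<star>\<^sub>0 Id2 []) f"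
| id0: "x \<in> lists (gens1 S) \<Longrightarrow> y \<in> lists (gens1 S) \<Longrightarrow>
    eq2 S (Id2 x \<star>\<^sub>0 Id2 y) (Id2 (x @ y))"
| exchange: "hom2 S f x y \<Longrightarrow> hom2 S g y z \<Longrightarrow> hom2 S f' x' y' \<Longrightarrow> hom2 S g' y' z' \<Longrightarrow>
    eq2 S ((f \<star>\<^sub>1 g) \<star>\<^sub>0 (f' \<star>\<^sub>1 g')) ((f \<star>\<^sub>0 f') \<star>\<^sub>1 (g \<star>\<^sub>0 g'))"


subsection \<open>\<open>(3,1)\<close>-polygraphs and coherent presentations\<close>

record ('a, 'b, 'c) polygraph31 = "('a, 'b) polygraph2" +
  gens3 :: "'c set"
  src3 :: "'c \<Rightarrow> ('a, 'b) cell2"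
  tgt3 :: "'c \<Rightarrow> ('a, 'b) cell2"

definition polygraph31 :: "('a, 'b, 'c, 'z) polygraph31_scheme \<Rightarrow> bool" where
  "polygraph31 S \<longleftrightarrow> polygraph2 S \<and>
     (\<forall>X\<in>gens3 S. \<exists>x y. hom2 S (src3 S X) x y \<and> hom2 S (tgt3 S X) x y)"

datatype ('a, 'b, 'c) cell3 =
    Gen3 'c
  | Id3 "('a, 'b) cell2"
  | Comp30 "('a, 'b, 'c) cell3" "('a, 'b, 'c) cell3"
  | Comp31 "('a, 'b, 'c) cell3" "('a, 'b, 'c) cell3"
  | Comp32 "('a, 'b, 'c) cell3" "('a, 'b, 'c) cell3"
  | Inv3 "('a, 'b, 'c) cell3"

text \<open>
  \<open>hom3 S A f g\<close> says that the expression \<open>A\<close> denotes a \<open>3\<close>-cell from \<open>f\<close> to \<open>g\<close> in the free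
  \<open>(3,1)\<close>-category. Source and target are \<open>2\<close>-cells of \<open>\<Sigma>\<^sub>2\<^sup>\<top>\<close>, hence only matter up to \<open>eq2\<close> (last
  rule). \<open>Inv3\<close> is the inverse for \<open>\<star>\<^sub>2\<close>; inverses for \<open>\<star>\<^sub>1\<close> are derivable by whiskering with
  inverse \<open>2\<close>-cells. The equations between \<open>3\<close>-cells are irrelevant for the existence of
  \<open>3\<close>-cells and are not needed.
\<close>

inductive hom3 ::
  "('a, 'b, 'c, 'z) polygraph31_scheme \<Rightarrow> ('a, 'b, 'c) cell3 \<Rightarrow>
   ('a, 'b) cell2 \<Rightarrow> ('a, 'b) cell2 \<Rightarrow> bool"
  for S where
  Gen3: "X \<in> gens3 S \<Longrightarrow> hom3 S (Gen3 X) (src3 S X) (tgt3 S X)"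
| Id3: "hom2 S f x y \<Longrightarrow> hom3 S (Id3 f) f f"
| Comp30: "hom3 S A f f' \<Longrightarrow> hom3 S B g g' \<Longrightarrow> hom3 S (Comp30 A B) (f \<star>\<^sub>0 g) (f' \<star>\<^sub>0 g')"
| Comp31: "hom3 S A f f' \<Longrightarrow> hom3 S B g g' \<Longrightarrow> hom2 S f x y \<Longrightarrow> hom2 S g y z \<Longrightarrow>
    hom3 S (Comp31 A B) (f \<star>\<^sub>1 g) (f' \<star>\<^sub>1 g')"
| Comp32: "hom3 S A f g \<Longrightarrow> hom3 S B g h \<Longrightarrow> hom3 S (Comp32 A B) f h"
| Inv3: "hom3 S A f g \<Longrightarrow> hom3 S (Inv3 A) g f"
| conv: "hom3 S A f g \<Longrightarrow> eq2 S f f' \<Longrightarrow> eq2 S g g' \<Longrightarrow> hom3 S A f' g'"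

definition coherent_presentation ::
  "('a, 'b, 'c, 'z) polygraph31_scheme \<Rightarrow> 'm monoid \<Rightarrow> bool" where
  "coherent_presentation S M \<longleftrightarrow> polygraph31 S \<and> presents S M \<and>
     (\<forall>f g x y. hom2 S f x y \<and> hom2 S g x y \<longrightarrow> (\<exists>A. hom3 S A f g))"


section \<open>Plactic monoids and Schensted insertion\<close>

definition knuth_polygraph :: "nat \<Rightarrow> (nat, nat list \<times> nat list) polygraph2" where
  "knuth_polygraph n =
     \<lparr>gens1 = {1..n},
      gens2 = {([z, x, y], [x, z, y]) | x y z. 1 \<le> x \<and> x \<le> y \<and> y < z \<and> z \<le> n}
            \<union> {([y, z, x], [y, x, z]) | x y z. 1 \<le> x \<and> x < y \<and> y \<le> z \<and> z \<le> n},
      src2 = fst,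
      tgt2 = snd\<rparr>"

definition plactic :: "nat \<Rightarrow> nat list set monoid" where
  "plactic n = presented_monoid (knuth_polygraph n)"

text \<open>
  The tableau \<open>u\<^sub>1 \<dots> u\<^sub>k\<close> is represented by the list \<open>[u\<^sub>k, \<dots>, u\<^sub>1]\<close> of its rows, the longest row
  \<open>u\<^sub>k\<close> coming first. In \<open>insert_letter\<close>, the index \<open>j\<close> is the least one with \<open>y < r ! j\<close>.
\<close>

fun insert_letter :: "nat list list \<Rightarrow> nat \<Rightarrow> nat list list" where
  "insert_letter [] y = [[y]]"
| "insert_letter (r # rs) y =
     (if sorted (r @ [y]) then (r @ [y]) # rs
      else let j = length (takeWhile (\<lambda>x. x \<le> y) r)
           in r[j := y] # insert_letter rs (r ! j))"

definition schensted :: "nat list \<Rightarrow> nat list list" where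
  "schensted w = foldl insert_letter [] w"

text \<open>
  The \<open>i\<close>-th column (counted from \<open>0\<close> on the left) of \<open>P(w)\<close>, read from bottom to top, where the
  row \<open>u\<^sub>k\<close> is on top; it is empty if \<open>P(w)\<close> has at most \<open>i\<close> columns.
\<close>

definition tab_col :: "nat list \<Rightarrow> nat \<Rightarrow> nat list" where
  "tab_col w i = [r ! i. r \<leftarrow> rev (schensted w), i < length r]"

definition tab_cols :: "nat list \<Rightarrow> nat list list" where
  "tab_cols w = map (tab_col w) [0..<(if schensted w = [] then 0 else length (hd (schensted w)))]"

abbreviation left_col :: "nat list \<Rightarrow> nat list" where
  "left_col w \<equiv> tab_col w 0"

abbreviation right_col :: "nat list \<Rightarrow> nat list" where
  "right_col w \<equiv> tab_col w 1"


section \<open>The column presentation and its \<open>3\<close>-cells\<close>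

definition col :: "nat \<Rightarrow> nat list set" where
  "col n = {u. u \<noteq> [] \<and> set u \<subseteq> {1..n} \<and> sorted_wrt (>) u}"

text \<open>A column \<open>x\<^sub>p \<dots> x\<^sub>1\<close> is a decreasing list, so \<open>x\<^sub>i\<close> is entry \<open>i - 1\<close> of its reversal.\<close>

definition forms_tableau :: "nat list \<Rightarrow> nat list \<Rightarrow> bool" where
  "forms_tableau u v \<longleftrightarrow> length v \<le> length u \<and> (\<forall>i<length v. rev u ! i \<le> rev v ! i)"

text \<open>
  The generator \<open>c\<^sub>u\<close> is the column \<open>u\<close> itself; \<open>col_word u\<close> is \<open>c\<^sub>u\<close> as a word, which is the empty
  word if \<open>u\<close> is empty. The generating \<open>2\<close>-cell \<open>\<alpha>\<^bsub>u,v\<^esub>\<close> is named by the pair \<open>(u, v)\<close>.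
\<close>

definition col_word :: "nat list \<Rightarrow> nat list list" where
  "col_word u = (if u = [] then [] else [u])"

type_synonym col_cell2 = "(nat list, nat list \<times> nat list) cell2"

definition Col2 :: "nat \<Rightarrow> (nat list, nat list \<times> nat list) polygraph2" where
  "Col2 n =
     \<lparr>gens1 = col n,
      gens2 = {(u, v). u \<in> col n \<and> v \<in> col n \<and> \<not> forms_tableau u v},
      src2 = (\<lambda>(u, v). [u, v]),
      tgt2 = (\<lambda>(u, v). col_word (left_col (u @ v)) @ col_word (right_col (u @ v)))\<rparr>"

definition alpha :: "nat list \<Rightarrow> nat list \<Rightarrow> col_cell2" where
  "alpha p q =
     (if p = [] \<or> q = [] \<or> forms_tableau p q then Id2 (col_word p @ col_word q) else Gen2 (p, q))"

definition X_src :: "nat list \<times> nat list \<times> nat list \<Rightarrow> col_cell2" where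
  "X_src = (\<lambda>(u, v, t).
     let e = left_col (u @ v); e' = right_col (u @ v);
         b = left_col (e' @ t); b' = right_col (e' @ t)
     in (alpha u v \<star>\<^sub>0 Id2 (col_word t))
        \<star>\<^sub>1 (Id2 (col_word e) \<star>\<^sub>0 alpha e' t)
        \<star>\<^sub>1 (alpha e b \<star>\<^sub>0 Id2 (col_word b')))"

definition X_tgt :: "nat list \<times> nat list \<times> nat list \<Rightarrow> col_cell2" where
  "X_tgt = (\<lambda>(u, v, t).
     let w = left_col (v @ t); w' = right_col (v @ t);
         a = left_col (u @ w); a' = right_col (u @ w)
     in (Id2 (col_word u) \<star>\<^sub>0 alpha v t)
        \<star>\<^sub>1 (alpha u w \<star>\<^sub>0 Id2 (col_word w'))
        \<star>\<^sub>1 (Id2 (col_word a) \<star>\<^sub>0 alpha a' w'))"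

definition Col3 ::
  "nat \<Rightarrow> (nat list, nat list \<times> nat list, nat list \<times> nat list \<times> nat list) polygraph31" where
  "Col3 n = polygraph2.extend (Col2 n)
     \<lparr>gens3 = {(u, v, t). u \<in> col n \<and> v \<in> col n \<and> t \<in> col n \<and>
                \<not> forms_tableau u v \<and> \<not> forms_tableau v t},
      src3 = X_src,
      tgt3 = X_tgt\<rparr>"

end

theory Submission
  imports Defs
begin

text \<open>
  Coherence is Squier's theorem: in a terminating rewriting system every parallel pair of 2-cells is
  filled as soon as all critical branchings are. The left-hand sides of the column relations have
  length two, so the critical branchings are exactly the sources of the cells \<open>\<X>\<^sub>u\<^sub>v\<^sub>t\<close>, and the
  point is that both composites of three steps end in the same word.

  Encode a column \<open>u\<close> by the function \<open>m \<mapsto> #{x \<in> u. x \<le> m}\<close>. Then \<open>(u, v)\<close> forms a tableau iff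
  \<open>v \<le> u\<close> pointwise, and the columns of \<open>P(uv)\<close> are \<open>u + g\<close> and \<open>v - g\<close>, where \<open>g\<close> is the running
  maximum of \<open>v - u\<close>. This is a Pitman transform, and Pitman transforms \<open>T\<^sub>1\<close>, \<open>T\<^sub>2\<close> of adjacent columns
  satisfy the braid relation \<open>T\<^sub>1T\<^sub>2T\<^sub>1 = T\<^sub>2T\<^sub>1T\<^sub>2\<close>, an identity between running maxima.

  That Schensted insertion computes the same columns does not require the invariance of \<open>P\<close> under
  the Knuth relations: the rewriting system given by the Pitman transforms is convergent, the Knuth
  relations hold in the monoid it presents, and the columns of \<open>P(w)\<close> form a word which is
  Knuth equivalent to \<open>w\<close> and irreducible, hence its normal form.
\<close>

section \<open>Squier's theorem for quadratic polygraphs\<close>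

fun dom2 :: "('a, 'b, 'z) polygraph2_scheme \<Rightarrow> ('a, 'b) cell2 \<Rightarrow> 'a list"
  and cod2 :: "('a, 'b, 'z) polygraph2_scheme \<Rightarrow> ('a, 'b) cell2 \<Rightarrow> 'a list" where
  "dom2 S (Gen2 \<alpha>) = src2 S \<alpha>"
| "dom2 S (Id2 x) = x"
| "dom2 S (f \<star>\<^sub>0 g) = dom2 S f @ dom2 S g"
| "dom2 S (f \<star>\<^sub>1 g) = dom2 S f"
| "dom2 S (Inv2 f) = cod2 S f"
| "cod2 S (Gen2 \<alpha>) = tgt2 S \<alpha>"
| "cod2 S (Id2 x) = x"
| "cod2 S (f \<star>\<^sub>0 g) = cod2 S f @ cod2 S g"
| "cod2 S (f \<star>\<^sub>1 g) = cod2 S g"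
| "cod2 S (Inv2 f) = dom2 S f"

fun cell2 :: "('a, 'b, 'z) polygraph2_scheme \<Rightarrow> ('a, 'b) cell2 \<Rightarrow> bool" where
  "cell2 S (Gen2 \<alpha>) \<longleftrightarrow> \<alpha> \<in> gens2 S"
| "cell2 S (Id2 x) \<longleftrightarrow> x \<in> lists (gens1 S)"
| "cell2 S (f \<star>\<^sub>0 g) \<longleftrightarrow> cell2 S f \<and> cell2 S g"
| "cell2 S (f \<star>\<^sub>1 g) \<longleftrightarrow> cell2 S f \<and> cell2 S g \<and> cod2 S f = dom2 S g"
| "cell2 S (Inv2 f) \<longleftrightarrow> cell2 S f"

text \<open>Source and target are functions of the expression, so inductive typing can be traded for
  the computable predicate \<open>cell2\<close>; typing obligations then reduce by
  simplification.\<close>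

lemma hom2_iff: "hom2 S f x y \<longleftrightarrow> cell2 S f \<and> dom2 S f = x \<and> cod2 S f = y"
proof
  show "hom2 S f x y \<Longrightarrow> cell2 S f \<and> dom2 S f = x \<and> cod2 S f = y"
    by (induction rule: hom2.induct) auto
  have "cell2 S f \<Longrightarrow> hom2 S f (dom2 S f) (cod2 S f)"
    by (induction f) (auto intro: hom2.intros)
  then show "cell2 S f \<and> dom2 S f = x \<and> cod2 S f = y \<Longrightarrow> hom2 S f x y"
    by blast
qed

lemma polygraph_cong_imp_hom2: "polygraph_cong S x y \<Longrightarrow> \<exists>f. hom2 S f x y"
  by (induction rule: polygraph_cong.induct) (blast intro: hom2.intros)+

text \<open>Packs well-typedness and parallelism together with the 3-cell, so that chains of
  \<open>eqv\<close> steps carry their own typing.\<close>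

definition eqv :: "('a, 'b, 'c, 'z) polygraph31_scheme \<Rightarrow> ('a, 'b) cell2 \<Rightarrow> ('a, 'b) cell2 \<Rightarrow> bool" where
  "eqv S f g \<longleftrightarrow> cell2 S f \<and> cell2 S g \<and> dom2 S f = dom2 S g \<and> cod2 S f = cod2 S g \<and>
     (\<exists>A. hom3 S A f g)"

definition whisk :: "'a list \<Rightarrow> ('a, 'b) cell2 \<Rightarrow> 'a list \<Rightarrow> ('a, 'b) cell2" where
  "whisk p f q = Id2 p \<star>\<^sub>0 (f \<star>\<^sub>0 Id2 q)"

lemma whisk_simps [simp]:
  "dom2 S (whisk p f q) = p @ dom2 S f @ q"
  "cod2 S (whisk p f q) = p @ cod2 S f @ q"
  "cell2 S (whisk p f q) \<longleftrightarrow> p \<in> lists (gens1 S) \<and> cell2 S f \<and> q \<in> lists (gens1 S)"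
  by (auto simp: whisk_def)

lemma eqvD:
  assumes "eqv S f g"
  shows "cell2 S f" "cell2 S g" "dom2 S g = dom2 S f" "cod2 S g = cod2 S f"
  using assms by (auto simp: eqv_def)

lemma hom2_self: "cell2 S f \<Longrightarrow> hom2 S f (dom2 S f) (cod2 S f)"
  by (simp add: hom2_iff)

text \<open>By the rule \<open>conv\<close>, an identity 3-cell also connects two different
  expressions of the same 2-cell.\<close>

lemma eqv_eq2:
  assumes "eq2 S f g" "cell2 S f" "cell2 S g" "dom2 S f = dom2 S g" "cod2 S f = cod2 S g"
  shows "eqv S f g"
  using assms hom3.conv[OF hom3.Id3[OF hom2_self[OF assms(2)]] eq2.refl[OF hom2_self[OF assms(2)]] assms(1)]
  unfolding eqv_def by blast

lemma eqv_refl: "cell2 S f \<Longrightarrow> eqv S f f"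
  unfolding eqv_def using hom3.Id3[OF hom2_self] by blast

lemma eqv_sym: "eqv S f g \<Longrightarrow> eqv S g f"
  unfolding eqv_def using hom3.Inv3 by metis

lemma eqv_trans [trans]: "eqv S f g \<Longrightarrow> eqv S g h \<Longrightarrow> eqv S f h"
  unfolding eqv_def using hom3.Comp32 by metis

lemma eqv_comp1:
  "eqv S f f' \<Longrightarrow> eqv S g g' \<Longrightarrow> cod2 S f = dom2 S g \<Longrightarrow> eqv S (f \<star>\<^sub>1 g) (f' \<star>\<^sub>1 g')"
  unfolding eqv_def cell2.simps dom2.simps cod2.simps
  using hom3.Comp31[OF _ _ hom2_self, of S _ f f' _ g g' "cod2 S g"]
  by (metis hom2_self)

lemma eqv_comp1_left:
  "eqv S g g' \<Longrightarrow> cell2 S f \<Longrightarrow> cod2 S f = dom2 S g \<Longrightarrow> eqv S (f \<star>\<^sub>1 g) (f \<star>\<^sub>1 g')"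
  by (intro eqv_comp1 eqv_refl)

lemma eqv_comp1_right:
  "eqv S f f' \<Longrightarrow> cell2 S g \<Longrightarrow> cod2 S f = dom2 S g \<Longrightarrow> eqv S (f \<star>\<^sub>1 g) (f' \<star>\<^sub>1 g)"
  by (intro eqv_comp1 eqv_refl)

lemma eqv_comp0: "eqv S f f' \<Longrightarrow> eqv S g g' \<Longrightarrow> eqv S (f \<star>\<^sub>0 g) (f' \<star>\<^sub>0 g')"
  unfolding eqv_def cell2.simps dom2.simps cod2.simps using hom3.Comp30 by metis

lemma eqv_assoc1:
  "cell2 S f \<Longrightarrow> cell2 S g \<Longrightarrow> cell2 S h \<Longrightarrow> cod2 S f = dom2 S g \<Longrightarrow> cod2 S g = dom2 S h \<Longrightarrow>
    eqv S ((f \<star>\<^sub>1 g) \<star>\<^sub>1 h) (f \<star>\<^sub>1 (g \<star>\<^sub>1 h))"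
  by (intro eqv_eq2 eq2.assoc1) (auto simp: hom2_iff)

lemma eqv_assoc0:
  "cell2 S f \<Longrightarrow> cell2 S g \<Longrightarrow> cell2 S h \<Longrightarrow> eqv S ((f \<star>\<^sub>0 g) \<star>\<^sub>0 h) (f \<star>\<^sub>0 (g \<star>\<^sub>0 h))"
  by (intro eqv_eq2 eq2.assoc0) (auto simp: hom2_iff)

lemma eqv_exchange:
  "cell2 S f \<Longrightarrow> cell2 S g \<Longrightarrow> cell2 S f' \<Longrightarrow> cell2 S g' \<Longrightarrow> cod2 S f = dom2 S g \<Longrightarrow> cod2 S f' = dom2 S g' \<Longrightarrow>
    eqv S ((f \<star>\<^sub>1 g) \<star>\<^sub>0 (f' \<star>\<^sub>1 g')) ((f \<star>\<^sub>0 f') \<star>\<^sub>1 (g \<star>\<^sub>0 g'))"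
  by (intro eqv_eq2 eq2.exchange) (auto simp: hom2_iff)

lemma eqv_id0:
  "x \<in> lists (gens1 S) \<Longrightarrow> y \<in> lists (gens1 S) \<Longrightarrow> eqv S (Id2 x \<star>\<^sub>0 Id2 y) (Id2 (x @ y))"
  by (intro eqv_eq2 eq2.id0) auto

lemma eqv_inv_left: "cell2 S f \<Longrightarrow> cod2 S f \<in> lists (gens1 S) \<Longrightarrow> eqv S (Inv2 f \<star>\<^sub>1 f) (Id2 (cod2 S f))"
  by (intro eqv_eq2 eq2.inv_left) (auto simp: hom2_iff)

lemma eqv_inv_right: "cell2 S f \<Longrightarrow> dom2 S f \<in> lists (gens1 S) \<Longrightarrow> eqv S (f \<star>\<^sub>1 Inv2 f) (Id2 (dom2 S f))"
  by (intro eqv_eq2 eq2.inv_right) (auto simp: hom2_iff)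

lemma eqv_unit0_left: "cell2 S f \<Longrightarrow> eqv S (Id2 [] \<star>\<^sub>0 f) f"
  by (intro eqv_eq2 eq2.unit0_left) (auto simp: hom2_iff)

lemma eqv_unit0_right: "cell2 S f \<Longrightarrow> eqv S (f \<star>\<^sub>0 Id2 []) f"
  by (intro eqv_eq2 eq2.unit0_right) (auto simp: hom2_iff)

section \<open>Calculus of whiskered 2-cells\<close>

locale polygraph =
  fixes S :: "('a, 'b, 'c, 'z) polygraph31_scheme"
  assumes polygraph2: "polygraph2 S"
begin

lemma cell2_words:
  assumes "cell2 S f"
  shows "dom2 S f \<in> lists (gens1 S)" "cod2 S f \<in> lists (gens1 S)"
  using assms polygraph2 by (induction f) (auto simp: polygraph2_def)

lemma eqv_unit1_left: "cell2 S f \<Longrightarrow> eqv S (Id2 (dom2 S f) \<star>\<^sub>1 f) f"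
  using cell2_words[of f] by (intro eqv_eq2 eq2.unit1_left) (auto simp: hom2_iff)

lemma eqv_unit1_right: "cell2 S f \<Longrightarrow> eqv S (f \<star>\<^sub>1 Id2 (cod2 S f)) f"
  using cell2_words[of f] by (intro eqv_eq2 eq2.unit1_right) (auto simp: hom2_iff)

lemma whisk_cong:
  "eqv S f g \<Longrightarrow> p \<in> lists (gens1 S) \<Longrightarrow> q \<in> lists (gens1 S) \<Longrightarrow> eqv S (whisk p f q) (whisk p g q)"
  unfolding whisk_def by (intro eqv_comp0 eqv_refl) auto

text \<open>Writing each identity on the context as a composite of two identities lets the exchange
  law distribute the context over the composite.\<close>

lemma whisk_comp1:
  assumes "cell2 S f" "cell2 S g" "cod2 S f = dom2 S g" "p \<in> lists (gens1 S)" "q \<in> lists (gens1 S)"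
  shows "eqv S (whisk p (f \<star>\<^sub>1 g) q) (whisk p f q \<star>\<^sub>1 whisk p g q)"
proof -
  have Id: "eqv S (Id2 x) (Id2 x \<star>\<^sub>1 Id2 x)" if "x \<in> lists (gens1 S)" for x
    using eqv_sym[OF eqv_unit1_left[of "Id2 x"]] that by simp
  have "eqv S (whisk p (f \<star>\<^sub>1 g) q) ((Id2 p \<star>\<^sub>1 Id2 p) \<star>\<^sub>0 ((f \<star>\<^sub>1 g) \<star>\<^sub>0 (Id2 q \<star>\<^sub>1 Id2 q)))"
    unfolding whisk_def using assms by (intro eqv_comp0 Id eqv_refl) auto
  also have "eqv S \<dots> ((Id2 p \<star>\<^sub>1 Id2 p) \<star>\<^sub>0 ((f \<star>\<^sub>0 Id2 q) \<star>\<^sub>1 (g \<star>\<^sub>0 Id2 q)))"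
    using assms by (intro eqv_comp0 eqv_refl eqv_exchange) auto
  also have "eqv S \<dots> (whisk p f q \<star>\<^sub>1 whisk p g q)"
    unfolding whisk_def using assms by (intro eqv_exchange) auto
  finally show ?thesis .
qed

lemma whisk_Id2:
  assumes "p \<in> lists (gens1 S)" "x \<in> lists (gens1 S)" "q \<in> lists (gens1 S)"
  shows "eqv S (whisk p (Id2 x) q) (Id2 (p @ x @ q))"
proof -
  have "eqv S (whisk p (Id2 x) q) (Id2 p \<star>\<^sub>0 Id2 (x @ q))"
    unfolding whisk_def using assms by (intro eqv_comp0 eqv_refl eqv_id0) auto
  also have "eqv S \<dots> (Id2 (p @ x @ q))"
    using assms by (intro eqv_id0) auto
  finally show ?thesis .
qed

lemma whisk_Nil:
  assumes "cell2 S f" shows "eqv S (whisk [] f []) f"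
proof -
  have "eqv S (whisk [] f []) (f \<star>\<^sub>0 Id2 [])"
    unfolding whisk_def using assms by (intro eqv_unit0_left) auto
  also have "eqv S \<dots> f" using assms by (intro eqv_unit0_right)
  finally show ?thesis .
qed

lemma whisk_whisk:
  assumes "cell2 S f" "p \<in> lists (gens1 S)" "q \<in> lists (gens1 S)"
    "p' \<in> lists (gens1 S)" "q' \<in> lists (gens1 S)"
  shows "eqv S (whisk p (whisk p' f q') q) (whisk (p @ p') f (q' @ q))"
proof -
  have "eqv S (whisk p (whisk p' f q') q) (Id2 p \<star>\<^sub>0 (Id2 p' \<star>\<^sub>0 ((f \<star>\<^sub>0 Id2 q') \<star>\<^sub>0 Id2 q)))"
    unfolding whisk_def using assms by (intro eqv_comp0 eqv_refl eqv_assoc0) auto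
  also have "eqv S \<dots> (Id2 p \<star>\<^sub>0 (Id2 p' \<star>\<^sub>0 (f \<star>\<^sub>0 (Id2 q' \<star>\<^sub>0 Id2 q))))"
    using assms by (intro eqv_comp0 eqv_refl eqv_assoc0) auto
  also have "eqv S \<dots> (Id2 p \<star>\<^sub>0 (Id2 p' \<star>\<^sub>0 (f \<star>\<^sub>0 Id2 (q' @ q))))"
    using assms by (intro eqv_comp0 eqv_refl eqv_id0) auto
  also have "eqv S \<dots> ((Id2 p \<star>\<^sub>0 Id2 p') \<star>\<^sub>0 (f \<star>\<^sub>0 Id2 (q' @ q)))"
    using assms by (intro eqv_sym[OF eqv_assoc0]) auto
  also have "eqv S \<dots> (whisk (p @ p') f (q' @ q))"
    unfolding whisk_def using assms by (intro eqv_comp0 eqv_refl eqv_id0) auto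
  finally show ?thesis .
qed

lemma whisk_Comp20_Id2:
  assumes "cell2 S f" "p \<in> lists (gens1 S)" "q \<in> lists (gens1 S)" "x \<in> lists (gens1 S)"
  shows "eqv S (whisk p (Id2 x \<star>\<^sub>0 f) q) (whisk (p @ x) f q)"
    and "eqv S (whisk p (f \<star>\<^sub>0 Id2 x) q) (whisk p f (x @ q))"
proof -
  have "eqv S (whisk p (Id2 x \<star>\<^sub>0 f) q) (whisk p (whisk x f []) q)"
    unfolding whisk_def[of x] using assms
    by (intro whisk_cong eqv_comp0 eqv_refl eqv_sym[OF eqv_unit0_right]) auto
  also have "eqv S \<dots> (whisk (p @ x) f ([] @ q))"
    using assms by (intro whisk_whisk) auto
  finally show "eqv S (whisk p (Id2 x \<star>\<^sub>0 f) q) (whisk (p @ x) f q)" by simp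
  have "eqv S (whisk p (f \<star>\<^sub>0 Id2 x) q) (whisk p (whisk [] f x) q)"
    unfolding whisk_def[of "[]"] using assms
    by (intro whisk_cong eqv_sym[OF eqv_unit0_left]) auto
  also have "eqv S \<dots> (whisk (p @ []) f (x @ q))"
    using assms by (intro whisk_whisk) auto
  finally show "eqv S (whisk p (f \<star>\<^sub>0 Id2 x) q) (whisk p f (x @ q))" by simp
qed

text \<open>Padding \<open>f\<close> and \<open>g\<close> with identities on opposite sides and
  applying the exchange law performs them one after the other, in either order.\<close>

lemma eqv_interchange:
  assumes "cell2 S f" "cell2 S g"
  shows "eqv S (f \<star>\<^sub>0 g) ((f \<star>\<^sub>0 Id2 (dom2 S g)) \<star>\<^sub>1 (Id2 (cod2 S f) \<star>\<^sub>0 g))"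
    and "eqv S (f \<star>\<^sub>0 g) ((Id2 (dom2 S f) \<star>\<^sub>0 g) \<star>\<^sub>1 (f \<star>\<^sub>0 Id2 (cod2 S g)))"
proof -
  note w = cell2_words[OF assms(1)] cell2_words[OF assms(2)]
  have "eqv S (f \<star>\<^sub>0 g) ((f \<star>\<^sub>1 Id2 (cod2 S f)) \<star>\<^sub>0 (Id2 (dom2 S g) \<star>\<^sub>1 g))"
    using assms by (intro eqv_comp0 eqv_sym[OF eqv_unit1_left] eqv_sym[OF eqv_unit1_right])
  also have "eqv S \<dots> ((f \<star>\<^sub>0 Id2 (dom2 S g)) \<star>\<^sub>1 (Id2 (cod2 S f) \<star>\<^sub>0 g))"
    using assms w by (intro eqv_exchange) auto
  finally show "eqv S (f \<star>\<^sub>0 g) ((f \<star>\<^sub>0 Id2 (dom2 S g)) \<star>\<^sub>1 (Id2 (cod2 S f) \<star>\<^sub>0 g))" .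
  have "eqv S (f \<star>\<^sub>0 g) ((Id2 (dom2 S f) \<star>\<^sub>1 f) \<star>\<^sub>0 (g \<star>\<^sub>1 Id2 (cod2 S g)))"
    using assms by (intro eqv_comp0 eqv_sym[OF eqv_unit1_left] eqv_sym[OF eqv_unit1_right])
  also have "eqv S \<dots> ((Id2 (dom2 S f) \<star>\<^sub>0 g) \<star>\<^sub>1 (f \<star>\<^sub>0 Id2 (cod2 S g)))"
    using assms w by (intro eqv_exchange) auto
  finally show "eqv S (f \<star>\<^sub>0 g) ((Id2 (dom2 S f) \<star>\<^sub>0 g) \<star>\<^sub>1 (f \<star>\<^sub>0 Id2 (cod2 S g)))" .
qed

text \<open>The two sequential forms together supply the filler for a pair of disjoint rewriting
  steps.\<close>

lemma whisk_Comp20: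
  assumes "cell2 S f" "cell2 S g" "p \<in> lists (gens1 S)" "q \<in> lists (gens1 S)"
  shows "eqv S (whisk p (f \<star>\<^sub>0 g) q) (whisk p f (dom2 S g @ q) \<star>\<^sub>1 whisk (p @ cod2 S f) g q)"
    and "eqv S (whisk p (f \<star>\<^sub>0 g) q) (whisk (p @ dom2 S f) g q \<star>\<^sub>1 whisk p f (cod2 S g @ q))"
proof -
  note w = cell2_words[OF assms(1)] cell2_words[OF assms(2)]
  have "eqv S (whisk p (f \<star>\<^sub>0 g) q) (whisk p ((f \<star>\<^sub>0 Id2 (dom2 S g)) \<star>\<^sub>1 (Id2 (cod2 S f) \<star>\<^sub>0 g)) q)"
    using assms by (intro whisk_cong eqv_interchange)
  also have "eqv S \<dots> (whisk p (f \<star>\<^sub>0 Id2 (dom2 S g)) q \<star>\<^sub>1 whisk p (Id2 (cod2 S f) \<star>\<^sub>0 g) q)"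
    using assms w by (intro whisk_comp1) auto
  also have "eqv S \<dots> (whisk p f (dom2 S g @ q) \<star>\<^sub>1 whisk (p @ cod2 S f) g q)"
    using assms w by (intro eqv_comp1 whisk_Comp20_Id2) auto
  finally show "eqv S (whisk p (f \<star>\<^sub>0 g) q) (whisk p f (dom2 S g @ q) \<star>\<^sub>1 whisk (p @ cod2 S f) g q)" .
  have "eqv S (whisk p (f \<star>\<^sub>0 g) q) (whisk p ((Id2 (dom2 S f) \<star>\<^sub>0 g) \<star>\<^sub>1 (f \<star>\<^sub>0 Id2 (cod2 S g))) q)"
    using assms by (intro whisk_cong eqv_interchange)
  also have "eqv S \<dots> (whisk p (Id2 (dom2 S f) \<star>\<^sub>0 g) q \<star>\<^sub>1 whisk p (f \<star>\<^sub>0 Id2 (cod2 S g)) q)"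
    using assms w by (intro whisk_comp1) auto
  also have "eqv S \<dots> (whisk (p @ dom2 S f) g q \<star>\<^sub>1 whisk p f (cod2 S g @ q))"
    using assms w by (intro eqv_comp1 whisk_Comp20_Id2) auto
  finally show "eqv S (whisk p (f \<star>\<^sub>0 g) q) (whisk (p @ dom2 S f) g q \<star>\<^sub>1 whisk p f (cod2 S g @ q))" .
qed

section \<open>Normalizing paths and naturality\<close>

definition irreducible_word :: "'a list \<Rightarrow> bool" where
  "irreducible_word x \<longleftrightarrow> x \<in> lists (gens1 S) \<and> (\<forall>p \<alpha> q. \<alpha> \<in> gens2 S \<longrightarrow> x \<noteq> p @ src2 S \<alpha> @ q)"

text \<open>\<open>N\<close> is the composite of an arbitrary sequence of rewriting steps down to an
  irreducible word. No strategy is fixed, so uniqueness up to 3-cells has to be proved.\<close>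

inductive normalizes :: "'a list \<Rightarrow> ('a, 'b) cell2 \<Rightarrow> 'a list \<Rightarrow> bool" where
  irred: "irreducible_word x \<Longrightarrow> normalizes x (Id2 x) x"
| step: "\<alpha> \<in> gens2 S \<Longrightarrow> p \<in> lists (gens1 S) \<Longrightarrow> q \<in> lists (gens1 S) \<Longrightarrow>
    normalizes (p @ tgt2 S \<alpha> @ q) N z \<Longrightarrow>
    normalizes (p @ src2 S \<alpha> @ q) (whisk p (Gen2 \<alpha>) q \<star>\<^sub>1 N) z"

text \<open>Composites of forward steps only. The weight never increases along such a cell, which is
  what the closing cells of a critical branching have to satisfy.\<close>

inductive positive :: "('a, 'b) cell2 \<Rightarrow> bool" where
  pos_Gen2: "\<alpha> \<in> gens2 S \<Longrightarrow> positive (Gen2 \<alpha>)"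
| pos_Id2: "x \<in> lists (gens1 S) \<Longrightarrow> positive (Id2 x)"
| pos_left: "positive f \<Longrightarrow> x \<in> lists (gens1 S) \<Longrightarrow> positive (Id2 x \<star>\<^sub>0 f)"
| pos_right: "positive f \<Longrightarrow> x \<in> lists (gens1 S) \<Longrightarrow> positive (f \<star>\<^sub>0 Id2 x)"
| pos_Comp21: "positive f \<Longrightarrow> positive g \<Longrightarrow> cod2 S f = dom2 S g \<Longrightarrow> positive (f \<star>\<^sub>1 g)"

lemma normalizesD:
  assumes "normalizes x N z"
  shows "cell2 S N" "dom2 S N = x" "cod2 S N = z" "irreducible_word z"
  using assms by (induction) (auto simp: irreducible_word_def)

lemma positive_cell2: "positive f \<Longrightarrow> cell2 S f"
  by (induction rule: positive.induct) auto

text \<open>Coherent confluence at \<open>x\<close>: normalizing paths agree up to a 3-cell, and not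
  only in their targets.\<close>

definition unique_nf :: "'a list \<Rightarrow> bool" where
  "unique_nf x \<longleftrightarrow> (\<forall>N z N' z'. normalizes x N z \<longrightarrow> normalizes x N' z' \<longrightarrow> z = z' \<and> eqv S N N')"

text \<open>Naturality of normalization along \<open>f\<close>, quantified over all normalizing
  paths at both ends.\<close>

definition natural_nf :: "('a, 'b) cell2 \<Rightarrow> bool" where
  "natural_nf f \<longleftrightarrow> cell2 S f \<and> (\<forall>N z N' z'. normalizes (dom2 S f) N z \<longrightarrow>
     normalizes (cod2 S f) N' z' \<longrightarrow> z = z' \<and> eqv S (f \<star>\<^sub>1 N') N)"

lemma natural_nfD:
  assumes "natural_nf f" "normalizes (dom2 S f) N z" "normalizes (cod2 S f) N' z'"
  shows "z = z'" "eqv S (f \<star>\<^sub>1 N') N"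
  using assms unfolding natural_nf_def by blast+

lemma natural_nf_cong:
  assumes "natural_nf f" "eqv S f g" shows "natural_nf g"
  unfolding natural_nf_def
proof (intro conjI allI impI)
  show "cell2 S g" using assms by (auto dest: eqvD)
  fix N z N' z' assume n: "normalizes (dom2 S g) N z" "normalizes (cod2 S g) N' z'"
  then have n': "normalizes (dom2 S f) N z" "normalizes (cod2 S f) N' z'"
    using eqvD[OF assms(2)] by auto
  note * = natural_nfD[OF assms(1) n']
  have "eqv S (g \<star>\<^sub>1 N') (f \<star>\<^sub>1 N')"
    using assms n normalizesD by (intro eqv_comp1_right eqv_sym[OF assms(2)]) (auto simp: natural_nf_def)
  with * show "z = z'" "eqv S (g \<star>\<^sub>1 N') N" by (blast intro: eqv_trans)+
qed

end

text \<open>\<open>quadratic\<close> limits proper overlaps to one letter, \<open>src2_inj\<close>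
  makes two steps with the same redex equal, and \<open>critical\<close> fills the one-letter
  overlaps by positive closing cells.\<close>

locale convergent_polygraph = polygraph S
  for S :: "('a, 'b, 'c, 'z) polygraph31_scheme" +
  fixes weight :: "'a list \<Rightarrow> nat"
  assumes quadratic: "\<alpha> \<in> gens2 S \<Longrightarrow> \<exists>u v. src2 S \<alpha> = [u, v]"
    and src2_inj: "inj_on (src2 S) (gens2 S)"
    and weight: "\<alpha> \<in> gens2 S \<Longrightarrow> p \<in> lists (gens1 S) \<Longrightarrow> q \<in> lists (gens1 S) \<Longrightarrow>
      weight (p @ tgt2 S \<alpha> @ q) < weight (p @ src2 S \<alpha> @ q)"
    and critical: "\<alpha> \<in> gens2 S \<Longrightarrow> \<beta> \<in> gens2 S \<Longrightarrow> src2 S \<alpha> = [u, v] \<Longrightarrow> src2 S \<beta> = [v, t] \<Longrightarrow>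
      \<exists>f g. positive f \<and> positive g \<and>
        eqv S ((Gen2 \<alpha> \<star>\<^sub>0 Id2 [t]) \<star>\<^sub>1 f) ((Id2 [u] \<star>\<^sub>0 Gen2 \<beta>) \<star>\<^sub>1 g)"
begin

section \<open>Newman's lemma with 3-cells\<close>

lemma tgt2_words: "\<alpha> \<in> gens2 S \<Longrightarrow> tgt2 S \<alpha> \<in> lists (gens1 S)"
  and src2_words: "\<alpha> \<in> gens2 S \<Longrightarrow> src2 S \<alpha> \<in> lists (gens1 S)"
  using polygraph2 by (auto simp: polygraph2_def)

lemma normalizes_exists: "x \<in> lists (gens1 S) \<Longrightarrow> \<exists>N z. normalizes x N z"
proof (induction x rule: measure_induct_rule[of weight])
  case (less x)
  show ?case
  proof (cases "irreducible_word x")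
    case True then show ?thesis by (blast intro: normalizes.irred)
  next
    case False
    with less.prems obtain p \<alpha> q where *: "\<alpha> \<in> gens2 S" "x = p @ src2 S \<alpha> @ q"
      by (auto simp: irreducible_word_def)
    with less.prems have pq: "p \<in> lists (gens1 S)" "q \<in> lists (gens1 S)" by auto
    from less.IH[of "p @ tgt2 S \<alpha> @ q"] obtain N z where "normalizes (p @ tgt2 S \<alpha> @ q) N z"
      using * pq weight[of \<alpha> p q] tgt2_words[of \<alpha>] by (auto simp del: append_assoc)
    with * pq show ?thesis by (blast intro: normalizes.step)
  qed
qed

text \<open>A normalizing path \<open>L\<close> of the middle word, which exists by termination,
  links the naturality of \<open>f\<close> to that of \<open>g\<close>.\<close>

lemma natural_nf_comp:
  assumes "natural_nf f" "natural_nf g" "cod2 S f = dom2 S g"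
  shows "natural_nf (f \<star>\<^sub>1 g)"
  unfolding natural_nf_def
proof (intro conjI allI impI)
  show "cell2 S (f \<star>\<^sub>1 g)" using assms by (auto simp: natural_nf_def)
  fix N z N' z' assume "normalizes (dom2 S (f \<star>\<^sub>1 g)) N z" "normalizes (cod2 S (f \<star>\<^sub>1 g)) N' z'"
  then have n: "normalizes (dom2 S f) N z" "normalizes (cod2 S g) N' z'" by auto
  have fg: "cell2 S f" "cell2 S g" using assms by (auto simp: natural_nf_def)
  obtain L y where L: "normalizes (cod2 S f) L y"
    using normalizes_exists[of "cod2 S f"] cell2_words[OF fg(1)] by blast
  have 1: "z = y" "eqv S (f \<star>\<^sub>1 L) N" using assms(1) n L by (auto simp: natural_nf_def)
  have 2: "y = z'" "eqv S (g \<star>\<^sub>1 N') L" using assms n L by (auto simp: natural_nf_def)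
  show "z = z'" using 1 2 by simp
  have "eqv S ((f \<star>\<^sub>1 g) \<star>\<^sub>1 N') (f \<star>\<^sub>1 (g \<star>\<^sub>1 N'))"
    using assms fg n normalizesD by (intro eqv_assoc1) auto
  also have "eqv S \<dots> (f \<star>\<^sub>1 L)"
    using assms fg 2 by (intro eqv_comp1_left) auto
  finally show "eqv S ((f \<star>\<^sub>1 g) \<star>\<^sub>1 N') N" using 1 eqv_trans by blast
qed

lemma natural_nf_Id2:
  assumes "unique_nf x" "x \<in> lists (gens1 S)" shows "natural_nf (Id2 x)"
  unfolding natural_nf_def
proof (intro conjI allI impI)
  show "cell2 S (Id2 x)" using assms by simp
  fix N z N' z' assume "normalizes (dom2 S (Id2 x)) N z" "normalizes (cod2 S (Id2 x)) N' z'"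
  with assms have n: "normalizes x N' z'" "z = z'" "eqv S N' N" by (auto simp: unique_nf_def)
  then show "z = z'" by simp
  have "eqv S (Id2 x \<star>\<^sub>1 N') N'" using eqv_unit1_left[of N'] normalizesD[OF n(1)] by auto
  with n show "eqv S (Id2 x \<star>\<^sub>1 N') N" by (auto intro: eqv_trans)
qed

text \<open>A step followed by a normalizing path of its target is a normalizing path of its source,
  so naturality reduces to uniqueness at the source.\<close>

lemma natural_nf_step:
  assumes "unique_nf (p @ src2 S \<alpha> @ q)" "\<alpha> \<in> gens2 S" "p \<in> lists (gens1 S)" "q \<in> lists (gens1 S)"
  shows "natural_nf (whisk p (Gen2 \<alpha>) q)"
  unfolding natural_nf_def
proof (intro conjI allI impI)
  show "cell2 S (whisk p (Gen2 \<alpha>) q)" using assms by simp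
  fix N z N' z' assume n: "normalizes (dom2 S (whisk p (Gen2 \<alpha>) q)) N z"
    "normalizes (cod2 S (whisk p (Gen2 \<alpha>) q)) N' z'"
  then have "normalizes (p @ src2 S \<alpha> @ q) (whisk p (Gen2 \<alpha>) q \<star>\<^sub>1 N') z'"
    using assms by (intro normalizes.step) auto
  with n assms(1) show "z = z'" "eqv S (whisk p (Gen2 \<alpha>) q \<star>\<^sub>1 N') N"
    by (auto simp: unique_nf_def)
qed

text \<open>All words met along a positive cell weigh at most as much as its source, so uniqueness
  for these words suffices; this much an induction on the weight can provide.\<close>

lemma natural_nf_positive:
  assumes "positive f" "p \<in> lists (gens1 S)" "q \<in> lists (gens1 S)"
    and "\<And>x. x \<in> lists (gens1 S) \<Longrightarrow> weight x \<le> weight (p @ dom2 S f @ q) \<Longrightarrow> unique_nf x"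
  shows "weight (p @ cod2 S f @ q) \<le> weight (p @ dom2 S f @ q) \<and> natural_nf (whisk p f q)"
  using assms
proof (induction arbitrary: p q rule: positive.induct)
  case (pos_Gen2 \<alpha>)
  then show ?case using weight[of \<alpha> p q] src2_words[of \<alpha>] natural_nf_step[of p \<alpha> q]
    by (auto simp: less_imp_le)
next
  case (pos_Id2 x)
  have "natural_nf (Id2 (p @ x @ q))" using pos_Id2 by (intro natural_nf_Id2) auto
  then show ?case using natural_nf_cong eqv_sym[OF whisk_Id2] pos_Id2 by auto
next
  case (pos_left f x)
  have "natural_nf (whisk (p @ x) f q)" "weight ((p @ x) @ cod2 S f @ q) \<le> weight ((p @ x) @ dom2 S f @ q)"
    using pos_left.IH[of "p @ x" q] pos_left.prems pos_left.hyps by auto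
  then show ?case
    using natural_nf_cong[OF _ eqv_sym[OF whisk_Comp20_Id2(1)], of p x f q] pos_left positive_cell2 by auto
next
  case (pos_right f x)
  have "natural_nf (whisk p f (x @ q))" "weight (p @ cod2 S f @ x @ q) \<le> weight (p @ dom2 S f @ x @ q)"
    using pos_right.IH[of p "x @ q"] pos_right.prems pos_right.hyps by auto
  then show ?case
    using natural_nf_cong[OF _ eqv_sym[OF whisk_Comp20_Id2(2)], of p f x q] pos_right positive_cell2 by auto
next
  case (pos_Comp21 f g)
  have f: "natural_nf (whisk p f q)" "weight (p @ cod2 S f @ q) \<le> weight (p @ dom2 S f @ q)"
    using pos_Comp21.IH(1)[of p q] pos_Comp21.prems by auto
  have g: "natural_nf (whisk p g q)" "weight (p @ cod2 S g @ q) \<le> weight (p @ dom2 S g @ q)"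
    using pos_Comp21.IH(2)[of p q] pos_Comp21.prems pos_Comp21.hyps f(2) by auto
  have "natural_nf (whisk p f q \<star>\<^sub>1 whisk p g q)"
    using f g pos_Comp21.hyps by (intro natural_nf_comp) auto
  moreover have "eqv S (whisk p f q \<star>\<^sub>1 whisk p g q) (whisk p (f \<star>\<^sub>1 g) q)"
    using pos_Comp21 positive_cell2 by (intro eqv_sym[OF whisk_comp1]) auto
  ultimately show ?case using natural_nf_cong f(2) g(2) pos_Comp21.hyps by auto
qed

lemma overlap_cases:
  assumes "p @ [a, b] @ q = p' @ [c, d] @ q'" "length p \<le> length p'"
  obtains "p' = p" "c = a" "d = b" "q' = q"
  | "p' = p @ [a]" "c = b" "q = d # q'"
  | m where "p' = p @ [a, b] @ m" "q = m @ [c, d] @ q'"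
proof -
  have p: "take (length p) p' = p"
    using arg_cong[OF assms(1), of "take (length p)"] assms(2) by simp
  then obtain r where r: "p' = p @ r" by (metis append_take_drop_id)
  with assms(1) have "[a, b] @ q = r @ [c, d] @ q'" by simp
  with r that show ?thesis by (cases r; cases "tl r") auto
qed

text \<open>Coinciding redexes are trivial, a one-letter overlap is closed by
  \<open>critical\<close>, and disjoint steps commute by exchange. The closing cells start at words
  lighter than the source, so they are natural by \<open>unique\<close>.\<close>

lemma local_confluence:
  assumes \<alpha>: "\<alpha> \<in> gens2 S" "p \<in> lists (gens1 S)" "q \<in> lists (gens1 S)"
    and \<beta>: "\<beta> \<in> gens2 S" "p' \<in> lists (gens1 S)" "q' \<in> lists (gens1 S)"
    and eq: "p @ src2 S \<alpha> @ q = p' @ src2 S \<beta> @ q'"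
    and le: "length p \<le> length p'"
    and unique: "\<And>x. x \<in> lists (gens1 S) \<Longrightarrow> weight x < weight (p @ src2 S \<alpha> @ q) \<Longrightarrow> unique_nf x"
  shows "\<exists>r r'. natural_nf r \<and> natural_nf r' \<and>
    eqv S (whisk p (Gen2 \<alpha>) q \<star>\<^sub>1 r) (whisk p' (Gen2 \<beta>) q' \<star>\<^sub>1 r')"
proof -
  obtain a b where ab: "src2 S \<alpha> = [a, b]" using quadratic \<alpha> by blast
  obtain c d where cd: "src2 S \<beta> = [c, d]" using quadratic \<beta> by blast
  have w: "weight (p @ tgt2 S \<alpha> @ q) < weight (p @ src2 S \<alpha> @ q)"
    "weight (p' @ tgt2 S \<beta> @ q') < weight (p @ src2 S \<alpha> @ q)"
    using weight[OF \<alpha>] weight[OF \<beta>] eq by simp_all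
  note words = src2_words[OF \<alpha>(1)] src2_words[OF \<beta>(1)] tgt2_words[OF \<alpha>(1)] tgt2_words[OF \<beta>(1)]
  from eq ab cd le have "p @ [a, b] @ q = p' @ [c, d] @ q'" by simp
  then show ?thesis using le
  proof (cases rule: overlap_cases)
    case 1
    then have eq': "\<beta> = \<alpha>" using src2_inj \<alpha> \<beta> ab cd by (auto simp: inj_on_def)
    let ?r = "Id2 (p @ tgt2 S \<alpha> @ q)"
    have "natural_nf ?r" using unique[OF _ w(1)] words \<alpha> by (intro natural_nf_Id2) auto
    moreover have "eqv S (whisk p (Gen2 \<alpha>) q \<star>\<^sub>1 ?r) (whisk p (Gen2 \<alpha>) q \<star>\<^sub>1 ?r)"
      using \<alpha> words by (intro eqv_refl) auto
    ultimately show ?thesis using 1 eq' by blast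
  next
    case 2
    obtain f g where fg: "positive f" "positive g"
      "eqv S ((Gen2 \<alpha> \<star>\<^sub>0 Id2 [d]) \<star>\<^sub>1 f) ((Id2 [a] \<star>\<^sub>0 Gen2 \<beta>) \<star>\<^sub>1 g)"
      using critical[OF \<alpha>(1) \<beta>(1) ab] cd 2 by auto
    have ad: "a \<in> gens1 S" "d \<in> gens1 S" using words ab cd by auto
    have types: "tgt2 S \<alpha> @ [d] = dom2 S f" "a # tgt2 S \<beta> = dom2 S g"
      using eqvD[OF fg(3)] by auto
    have nf: "natural_nf (whisk p f q')" "natural_nf (whisk p g q')"
    proof -
      have "p @ dom2 S f @ q' = p @ tgt2 S \<alpha> @ q" "p @ dom2 S g @ q' = p' @ tgt2 S \<beta> @ q'"
        using 2 by (simp_all flip: types)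
      then show "natural_nf (whisk p f q')" "natural_nf (whisk p g q')"
        using natural_nf_positive[OF fg(1) \<alpha>(2) \<beta>(3)] natural_nf_positive[OF fg(2) \<alpha>(2) \<beta>(3)]
          unique w by (metis le_less_trans)+
    qed
    have "eqv S (whisk p (Gen2 \<alpha>) q \<star>\<^sub>1 whisk p f q') (whisk p (Gen2 \<alpha> \<star>\<^sub>0 Id2 [d]) q' \<star>\<^sub>1 whisk p f q')"
      using whisk_Comp20_Id2(2)[of "Gen2 \<alpha>" p q' "[d]"] \<alpha> \<beta> 2 ad types positive_cell2[OF fg(1)]
      by (intro eqv_comp1_right) (auto intro: eqv_sym simp flip: types)
    also have "eqv S \<dots> (whisk p ((Gen2 \<alpha> \<star>\<^sub>0 Id2 [d]) \<star>\<^sub>1 f) q')"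
      using \<alpha> \<beta> ad types positive_cell2[OF fg(1)] by (intro eqv_sym[OF whisk_comp1]) auto
    also have "eqv S \<dots> (whisk p ((Id2 [a] \<star>\<^sub>0 Gen2 \<beta>) \<star>\<^sub>1 g) q')"
      using \<alpha> \<beta> by (intro whisk_cong fg) auto
    also have "eqv S \<dots> (whisk p (Id2 [a] \<star>\<^sub>0 Gen2 \<beta>) q' \<star>\<^sub>1 whisk p g q')"
      using \<alpha> \<beta> ad types positive_cell2[OF fg(2)] by (intro whisk_comp1) auto
    also have "eqv S \<dots> (whisk p' (Gen2 \<beta>) q' \<star>\<^sub>1 whisk p g q')"
      using whisk_Comp20_Id2(1)[of "Gen2 \<beta>" p q' "[a]"] \<alpha> \<beta> 2 ad types positive_cell2[OF fg(2)]
      by (intro eqv_comp1_right) (auto simp flip: types)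
    finally show ?thesis using nf by blast
  next
    case (3 m)
    have m: "m \<in> lists (gens1 S)" using \<alpha> 3 by auto
    let ?r = "whisk (p @ tgt2 S \<alpha> @ m) (Gen2 \<beta>) q'" and ?r' = "whisk p (Gen2 \<alpha>) (m @ tgt2 S \<beta> @ q')"
    have nf: "natural_nf ?r" "natural_nf ?r'"
    proof -
      show "natural_nf ?r"
        using unique[OF _ w(1)] \<alpha> \<beta> words m 3 cd by (intro natural_nf_step) auto
      show "natural_nf ?r'"
        using unique[OF _ w(2)] \<alpha> \<beta> words m 3 ab by (intro natural_nf_step) auto
    qed
    \<comment> \<open>The idle middle word \<open>m\<close> is absorbed into the second step, which
      leaves the exchange of two adjacent cells.\<close>
    let ?h = "Id2 m \<star>\<^sub>0 Gen2 \<beta>"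
    have h: "cell2 S ?h" using m \<beta> by simp
    have "eqv S (whisk p (Gen2 \<alpha>) q \<star>\<^sub>1 ?r) (whisk p (Gen2 \<alpha>) (dom2 S ?h @ q') \<star>\<^sub>1 whisk (p @ tgt2 S \<alpha>) ?h q')"
      using eqv_sym[OF whisk_Comp20_Id2(1)[of "Gen2 \<beta>" "p @ tgt2 S \<alpha>" q' m]] \<alpha> \<beta> m words 3 cd
      by (intro eqv_comp1) (auto intro: eqv_refl)
    also have "eqv S \<dots> (whisk p (Gen2 \<alpha> \<star>\<^sub>0 ?h) q')"
      using eqv_sym[OF whisk_Comp20(1)[of "Gen2 \<alpha>" ?h p q']] \<alpha> \<beta> h by simp
    also have "eqv S \<dots> (whisk (p @ src2 S \<alpha>) ?h q' \<star>\<^sub>1 whisk p (Gen2 \<alpha>) (cod2 S ?h @ q'))"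
      using whisk_Comp20(2)[of "Gen2 \<alpha>" ?h p q'] \<alpha> \<beta> h by simp
    also have "eqv S \<dots> (whisk p' (Gen2 \<beta>) q' \<star>\<^sub>1 ?r')"
      using whisk_Comp20_Id2(1)[of "Gen2 \<beta>" "p @ src2 S \<alpha>" q' m] \<alpha> \<beta> m words 3 ab
      by (intro eqv_comp1) (auto intro: eqv_refl)
    finally show ?thesis using nf by blast
  qed
qed

text \<open>Well-founded induction as in Newman's lemma, with each local branching filled by a
  3-cell instead of merely joined.\<close>

lemma confluence: "x \<in> lists (gens1 S) \<Longrightarrow> unique_nf x"
proof (induction x rule: measure_induct_rule[of weight])
  case (less x)
  show ?case unfolding unique_nf_def
  proof (intro allI impI)
    fix N z N' z' assume n: "normalizes x N z" "normalizes x N' z'"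
    from n(1) show "z = z' \<and> eqv S N N'"
    proof cases
      case irred
      from n(2) show ?thesis
      proof cases
        case irred' : irred
        then show ?thesis using irred less.prems by (auto intro: eqv_refl)
      next
        case (step \<beta> p' q' M')
        then show ?thesis using irred unfolding irreducible_word_def by blast
      qed
    next
      case \<alpha>: (step \<alpha> p q M)
      from n(2) show ?thesis
      proof cases
        case irred
        then show ?thesis using \<alpha> unfolding irreducible_word_def by blast
      next
        case \<beta>: (step \<beta> p' q' M')
        let ?s = "whisk p (Gen2 \<alpha>) q" and ?s' = "whisk p' (Gen2 \<beta>) q'"
        have "\<exists>r r'. natural_nf r \<and> natural_nf r' \<and> eqv S (?s \<star>\<^sub>1 r) (?s' \<star>\<^sub>1 r')"
        proof (cases "length p \<le> length p'")
          case True
          then show ?thesis using local_confluence[of \<alpha> p q \<beta> p' q'] \<alpha> \<beta> less.IH by auto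
        next
          case False
          then have "\<exists>r r'. natural_nf r \<and> natural_nf r' \<and> eqv S (?s' \<star>\<^sub>1 r) (?s \<star>\<^sub>1 r')"
            using local_confluence[of \<beta> p' q' \<alpha> p q] \<alpha> \<beta> less.IH by auto
          then show ?thesis by (blast intro: eqv_sym)
        qed
        then obtain r r' where r: "natural_nf r" "natural_nf r'" "eqv S (?s \<star>\<^sub>1 r) (?s' \<star>\<^sub>1 r')" by blast
        have cr: "cell2 S r" "cell2 S r'" "dom2 S r = p @ tgt2 S \<alpha> @ q" "dom2 S r' = p' @ tgt2 S \<beta> @ q'"
          "cod2 S r' = cod2 S r" and cs: "cell2 S ?s" "cell2 S ?s'"
          using eqvD[OF r(3)] by auto
        \<comment> \<open>\<open>r\<close> and \<open>r'\<close> end in the same word; naturality of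
          both compares \<open>M\<close> and \<open>M'\<close> with a normalizing path
          \<open>L\<close> of that word.\<close>
        obtain L y where L: "normalizes (cod2 S r) L y"
          using normalizes_exists cell2_words cr by blast
        note M = normalizesD[OF \<open>normalizes (p @ tgt2 S \<alpha> @ q) M z\<close>]
          normalizesD[OF \<open>normalizes (p' @ tgt2 S \<beta> @ q') M' z'\<close>] normalizesD[OF L]
        have 1: "z = y" "eqv S (r \<star>\<^sub>1 L) M"
          using r(1) L \<alpha> cr unfolding natural_nf_def by auto
        have 2: "z' = y" "eqv S (r' \<star>\<^sub>1 L) M'"
          using r(2) L \<beta> cr unfolding natural_nf_def by auto
        have "eqv S N (?s \<star>\<^sub>1 (r \<star>\<^sub>1 L))"
          unfolding \<alpha> using cs cr by (intro eqv_comp1_left eqv_sym[OF 1(2)]) (auto simp: M)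
        also have "eqv S \<dots> ((?s \<star>\<^sub>1 r) \<star>\<^sub>1 L)"
          using cs cr M by (intro eqv_sym[OF eqv_assoc1]) auto
        also have "eqv S \<dots> ((?s' \<star>\<^sub>1 r') \<star>\<^sub>1 L)"
          using r cr M by (intro eqv_comp1_right) auto
        also have "eqv S \<dots> (?s' \<star>\<^sub>1 (r' \<star>\<^sub>1 L))"
          using cs cr M by (intro eqv_assoc1) auto
        also have "eqv S \<dots> N'"
          unfolding \<beta> using cs cr by (intro eqv_comp1_left 2(2)) auto
        finally show ?thesis using 1 2 by simp
      qed
    qed
  qed
qed

section \<open>Naturality for all 2-cells, and coherence\<close>

lemma natural_nf_whisk:
  "cell2 S f \<Longrightarrow> p \<in> lists (gens1 S) \<Longrightarrow> q \<in> lists (gens1 S) \<Longrightarrow> natural_nf (whisk p f q)"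
proof (induction f arbitrary: p q)
  case (Gen2 \<alpha>)
  then show ?case using src2_words[of \<alpha>] by (intro natural_nf_step confluence) auto
next
  case (Id2 x)
  then have "natural_nf (Id2 (p @ x @ q))" by (intro natural_nf_Id2 confluence) auto
  then show ?case using natural_nf_cong[OF _ eqv_sym[OF whisk_Id2]] Id2 by auto
next
  case (Comp20 f g)
  then have fg: "cell2 S f" "cell2 S g" by auto
  have "natural_nf (whisk p f (dom2 S g @ q) \<star>\<^sub>1 whisk (p @ cod2 S f) g q)"
    using Comp20 cell2_words[OF fg(1)] cell2_words[OF fg(2)] by (intro natural_nf_comp) auto
  then show ?case using natural_nf_cong[OF _ eqv_sym[OF whisk_Comp20(1)]] Comp20 by auto
next
  case (Comp21 f g)
  then have "natural_nf (whisk p f q \<star>\<^sub>1 whisk p g q)" by (intro natural_nf_comp) auto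
  then show ?case using natural_nf_cong[OF _ eqv_sym[OF whisk_comp1]] Comp21 by auto
next
  case (Inv2 f)
  then have f: "cell2 S f" "natural_nf (whisk p f q)" by auto
  note w = cell2_words[OF f(1)]
  show ?case unfolding natural_nf_def
  proof (intro conjI allI impI)
    show c: "cell2 S (whisk p (Inv2 f) q)" using Inv2 by simp
    fix N z N' z' assume n: "normalizes (dom2 S (whisk p (Inv2 f) q)) N z"
      "normalizes (cod2 S (whisk p (Inv2 f) q)) N' z'"
    have *: "z = z'" "eqv S (whisk p f q \<star>\<^sub>1 N) N'"
      using natural_nfD[OF f(2), of N' z' N z] n by auto
    then show "z = z'" by simp
    have N: "cell2 S N" "dom2 S N = p @ cod2 S f @ q" using normalizesD[OF n(1)] by auto
    \<comment> \<open>Naturality of \<open>f\<close>, read backwards, rewrites \<open>N'\<close> as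
      \<open>f\<close> followed by \<open>N\<close>; then \<open>Inv2 f\<close> cancels against
      \<open>f\<close>.\<close>
    have "eqv S (whisk p (Inv2 f) q \<star>\<^sub>1 N') (whisk p (Inv2 f) q \<star>\<^sub>1 (whisk p f q \<star>\<^sub>1 N))"
      using c by (intro eqv_comp1_left eqv_sym[OF *(2)]) (auto simp: normalizesD[OF n(2)])
    also have "eqv S \<dots> ((whisk p (Inv2 f) q \<star>\<^sub>1 whisk p f q) \<star>\<^sub>1 N)"
      using N f Inv2.prems by (intro eqv_sym[OF eqv_assoc1]) auto
    also have "eqv S \<dots> (whisk p (Inv2 f \<star>\<^sub>1 f) q \<star>\<^sub>1 N)"
      using N f Inv2.prems by (intro eqv_comp1_right eqv_sym[OF whisk_comp1]) auto
    also have "eqv S \<dots> (whisk p (Id2 (cod2 S f)) q \<star>\<^sub>1 N)"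
      using N f w Inv2.prems by (intro eqv_comp1_right whisk_cong eqv_inv_left) auto
    also have "eqv S \<dots> (Id2 (dom2 S N) \<star>\<^sub>1 N)"
      unfolding N(2) using N f w Inv2.prems by (intro eqv_comp1_right whisk_Id2) auto
    also have "eqv S \<dots> N" using N by (intro eqv_unit1_left)
    finally show "eqv S (whisk p (Inv2 f) q \<star>\<^sub>1 N') N" .
  qed
qed

lemma natural_nf_cell2: "cell2 S f \<Longrightarrow> natural_nf f"
  using natural_nf_whisk[of f "[]" "[]"] natural_nf_cong whisk_Nil by auto

text \<open>Irreducible words are their own normal forms, and naturality of a connecting cell
  identifies the normal forms of its two ends.\<close>

lemma irreducible_word_unique:
  assumes "polygraph_cong S x y" "irreducible_word x" "irreducible_word y"
  shows "x = y"
proof -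
  obtain f where "hom2 S f x y" using polygraph_cong_imp_hom2[OF assms(1)] by blast
  then have f: "cell2 S f" "dom2 S f = x" "cod2 S f = y" by (auto simp: hom2_iff)
  from natural_nf_cell2[OF f(1)] show ?thesis
    using normalizes.irred[OF assms(2)] normalizes.irred[OF assms(3)] f(2,3)
    unfolding natural_nf_def by blast
qed

text \<open>Squier's argument: naturality solves for an arbitrary cell \<open>h\<close> as
  \<open>M \<star>\<^sub>1 Inv2 N\<close>, where \<open>M\<close> and \<open>N\<close> depend only
  on the two ends of \<open>h\<close>.\<close>

theorem parallel_cells_equivalent:
  assumes "hom2 S f x y" "hom2 S g x y"
  shows "\<exists>A. hom3 S A f g"
proof -
  have fg: "cell2 S f" "cell2 S g" "dom2 S f = x" "cod2 S f = y" "dom2 S g = x" "cod2 S g = y"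
    using assms by (auto simp: hom2_iff)
  obtain M z where M: "normalizes x M z" using normalizes_exists cell2_words fg by blast
  obtain N z' where N: "normalizes y N z'" using normalizes_exists cell2_words fg by blast
  note N' = normalizesD[OF N]
  have cancel: "eqv S h (M \<star>\<^sub>1 Inv2 N)" if h: "cell2 S h" "dom2 S h = x" "cod2 S h = y" for h
  proof -
    have hN: "eqv S (h \<star>\<^sub>1 N) M"
      using natural_nf_cell2[OF h(1)] M N h unfolding natural_nf_def by blast
    have "eqv S h (h \<star>\<^sub>1 Id2 y)"
      using eqv_sym[OF eqv_unit1_right[OF h(1)]] h by simp
    also have "eqv S \<dots> (h \<star>\<^sub>1 (N \<star>\<^sub>1 Inv2 N))"
      using eqv_sym[OF eqv_inv_right[of S N]] h N' cell2_words[OF h(1)]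
      by (intro eqv_comp1_left) auto
    also have "eqv S \<dots> ((h \<star>\<^sub>1 N) \<star>\<^sub>1 Inv2 N)"
      using h N' by (intro eqv_sym[OF eqv_assoc1]) auto
    also have "eqv S \<dots> (M \<star>\<^sub>1 Inv2 N)"
      using h N' by (intro eqv_comp1_right hN) auto
    finally show ?thesis .
  qed
  have "eqv S f g"
    using eqv_trans[OF cancel[of f] eqv_sym[OF cancel[of g]]] fg by simp
  then show ?thesis by (simp add: eqv_def)
qed

end


section \<open>Pitman transforms of pairs of columns\<close>

fun runmax :: "(nat \<Rightarrow> int) \<Rightarrow> nat \<Rightarrow> int" where
  "runmax f 0 = f 0"
| "runmax f (Suc m) = max (runmax f m) (f (Suc m))"

lemma runmax_ge: "f m \<le> runmax f m"
  by (cases m) auto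

lemma runmax_ge_0: "f 0 \<le> runmax f m"
  by (induction m) auto

lemma runmax_eqI:
  assumes "g 0 = f 0" "\<And>m. g (Suc m) = max (g m) (f (Suc m))"
  shows "runmax f m = g m"
  using assms by (induction m) auto

text \<open>\<open>x\<close>, \<open>g\<close>, \<open>y\<close>, \<open>z\<close>, \<open>w\<close>
  stand for running maxima at one index, \<open>a'\<close> and \<open>b'\<close> for the next values
  of the sequences. The disjunction makes \<open>z = g + w\<close> inductive: where \<open>z\<close>
  falls short of \<open>g + x\<close>, the value \<open>y\<close> attains its upper bound.\<close>

lemma runmax_braid_step:
  fixes a' b b' g w x y z :: int
  assumes "z = g + w" "y \<le> x + g" "g + x \<le> z \<or> y = x + g" "z \<le> g + x" "b + x \<le> z" "b \<le> g" "b' \<le> b + 1"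
  shows "max z (b' + max x a') = max g b' + max w (b' - 2 * max g b' + max y (a' + max g b'))" (is ?A)
    "max y (a' + max g b') \<le> max x a' + max g b'" (is ?B)
    "max g b' + max x a' \<le> max z (b' + max x a') \<or> max y (a' + max g b') = max x a' + max g b'" (is ?C)
    "max z (b' + max x a') \<le> max g b' + max x a'" (is ?D)
proof -
  \<comment> \<open>By \<open>b' \<le> b + 1\<close> and \<open>b \<le> g\<close>, a new maximum of
    \<open>b\<close> exceeds the old one by exactly one and arises only from
    \<open>b = g\<close>.\<close>
  consider "b' \<le> g" "x \<le> a'" | "b' \<le> g" "a' \<le> x" | "b' = g + 1" "b = g" "x \<le> a'" | "b' = g + 1" "b = g" "a' \<le> x"
    using assms by linarith
  then have "?A \<and> ?B \<and> ?C \<and> ?D"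
  proof cases
    case 1
    have *: "max g b' = g" "max x a' = a'" "max y (a' + g) = a' + g"
      using assms 1 by (simp_all add: max_def)
    show ?thesis unfolding * by (intro conjI; use assms 1 in linarith)
  next
    case 2
    have *: "max g b' = g" "max x a' = x"
      using assms 2 by (simp_all add: max_def)
    show ?thesis unfolding * by (intro conjI; use assms 2 in linarith)
  next
    case 3
    have *: "max g b' = g + 1" "max x a' = a'" "max y (a' + (g + 1)) = a' + (g + 1)" "max z (b' + a') = b' + a'"
      "max w (b' - 2 * (g + 1) + (a' + (g + 1))) = a'"
      using assms 3 by (simp_all add: max_def)
    show ?thesis unfolding * by (intro conjI; use assms 3 in linarith)
  next
    case 4
    have *: "max g b' = g + 1" "max x a' = x" "max z (b' + x) = b' + x"
      "max w (b' - 2 * (g + 1) + max y (a' + (g + 1))) = x"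
      using assms 4 by (simp_all add: max_def)
    show ?thesis unfolding * by (intro conjI; use assms 4 in linarith)
  qed
  then show ?A ?B ?C ?D by blast+
qed

text \<open>One component of the braid relation, with \<open>a\<close> and \<open>b\<close> the
  differences of adjacent columns. The difference of two counting functions rises by at most one at
  a time, which gives \<open>step\<close>.\<close>

lemma runmax_braid:
  assumes step: "\<And>m. b (Suc m) \<le> b m + 1"
  shows "runmax (\<lambda>i. b i + runmax a i) m =
    runmax b m + runmax (\<lambda>i. b i - 2 * runmax b i + runmax (\<lambda>j. a j + runmax b j) i) m"
proof -
  let ?x = "runmax a" and ?g = "runmax b" and ?y = "runmax (\<lambda>j. a j + runmax b j)"
    and ?z = "runmax (\<lambda>i. b i + runmax a i)"
    and ?w = "runmax (\<lambda>i. b i - 2 * runmax b i + runmax (\<lambda>j. a j + runmax b j) i)"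
  have "?z m = ?g m + ?w m \<and> ?y m \<le> ?x m + ?g m \<and> (?g m + ?x m \<le> ?z m \<or> ?y m = ?x m + ?g m) \<and>
      ?z m \<le> ?g m + ?x m \<and> b m + ?x m \<le> ?z m \<and> b m \<le> ?g m"
  proof (induction m)
    case (Suc m)
    then show ?case
      using runmax_braid_step[of "?z m" "?g m" "?w m" "?y m" "?x m" "b m" "b (Suc m)" "a (Suc m)"] step[of m]
        max.cobounded2
      unfolding runmax.simps by blast
  qed simp
  then show ?thesis by simp
qed

section \<open>Counting functions of sets of letters\<close>

definition cnt :: "nat set \<Rightarrow> nat \<Rightarrow> int" where
  "cnt A m = int (card (A \<inter> {..m}))"

lemma cnt_0: "0 \<notin> A \<Longrightarrow> cnt A 0 = 0"
  by (simp add: cnt_def)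

lemma cnt_Suc: "cnt A (Suc m) = cnt A m + (if Suc m \<in> A then 1 else 0)"
proof -
  have "A \<inter> {..Suc m} = (if Suc m \<in> A then insert (Suc m) (A \<inter> {..m}) else A \<inter> {..m})"
    by (auto simp: le_Suc_eq)
  then show ?thesis by (simp add: cnt_def)
qed

lemma cnt_inj:
  assumes "0 \<notin> A" "0 \<notin> B" "\<And>m. cnt A m = cnt B m"
  shows "A = B"
proof (rule Set.set_eqI)
  fix m show "m \<in> A \<longleftrightarrow> m \<in> B"
  proof (cases m)
    case (Suc k)
    then show ?thesis using assms(3)[of k] assms(3)[of "Suc k"] cnt_Suc[of A k] cnt_Suc[of B k]
      by (auto split: if_splits)
  qed (use assms in auto)
qed

lemma cnt_insert: "finite A \<Longrightarrow> x \<notin> A \<Longrightarrow> cnt (insert x A) m = cnt A m + (if x \<le> m then 1 else 0)"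
  by (auto simp: cnt_def Int_insert_left)

lemma cnt_empty [simp]: "cnt {} m = 0"
  by (simp add: cnt_def)

text \<open>The strict record times of \<open>cnt V - cnt U\<close>: the letters which leave \<open>V\<close> for \<open>U\<close>.\<close>

definition moved :: "nat set \<Rightarrow> nat set \<Rightarrow> nat set" where
  "moved U V = {Suc m | m. runmax (\<lambda>i. cnt V i - cnt U i) m < cnt V (Suc m) - cnt U (Suc m)}"

lemma Suc_in_moved_iff:
  "Suc m \<in> moved U V \<longleftrightarrow> runmax (\<lambda>i. cnt V i - cnt U i) m < cnt V (Suc m) - cnt U (Suc m)"
  by (auto simp: moved_def)

text \<open>A new record needs an upward jump of the difference, hence a letter of \<open>V\<close>
  that is missing in \<open>U\<close>.\<close>

lemma moved_subset: "moved U V \<subseteq> V - U"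
proof
  fix m assume "m \<in> moved U V"
  then obtain k where "m = Suc k" "runmax (\<lambda>i. cnt V i - cnt U i) k < cnt V (Suc k) - cnt U (Suc k)"
    by (auto simp: moved_def)
  then show "m \<in> V - U"
    using runmax_ge[of "\<lambda>i. cnt V i - cnt U i" k] by (auto simp: cnt_Suc split: if_splits)
qed

text \<open>The difference jumps up by at most one, so its running maximum grows by exactly one at
  each record and is constant elsewhere.\<close>

lemma cnt_moved:
  assumes "0 \<notin> U" "0 \<notin> V"
  shows "cnt (U \<union> moved U V) m = cnt U m + runmax (\<lambda>i. cnt V i - cnt U i) m"
    and "cnt (V - moved U V) m = cnt V m - runmax (\<lambda>i. cnt V i - cnt U i) m"
proof -
  have *: "runmax (\<lambda>i. cnt V i - cnt U i) (Suc k) =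
      runmax (\<lambda>i. cnt V i - cnt U i) k + (if Suc k \<in> moved U V then 1 else 0)" for k
    using runmax_ge[of "\<lambda>i. cnt V i - cnt U i" k] by (auto simp: Suc_in_moved_iff cnt_Suc)
  have "cnt (U \<union> moved U V) m = cnt U m + runmax (\<lambda>i. cnt V i - cnt U i) m \<and>
    cnt (V - moved U V) m = cnt V m - runmax (\<lambda>i. cnt V i - cnt U i) m"
  proof (induction m)
    case 0
    have "0 \<notin> U \<union> moved U V" "0 \<notin> V - moved U V" using assms moved_subset[of U V] by auto
    then show ?case using assms by (simp add: cnt_0)
  next
    case (Suc m)
    then show ?case using moved_subset[of U V] unfolding * cnt_Suc by auto
  qed
  then show "cnt (U \<union> moved U V) m = cnt U m + runmax (\<lambda>i. cnt V i - cnt U i) m"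
    "cnt (V - moved U V) m = cnt V m - runmax (\<lambda>i. cnt V i - cnt U i) m" by auto
qed

section \<open>Columns, possibly empty, and their Pitman transforms\<close>

definition col0 :: "nat \<Rightarrow> nat list set" where
  "col0 n = {u. set u \<subseteq> {1..n} \<and> sorted_wrt (>) u}"

definition col_of :: "nat set \<Rightarrow> nat list" where
  "col_of A = rev (sorted_list_of_set A)"

definition lcol :: "nat list \<Rightarrow> nat list \<Rightarrow> nat list" where
  "lcol u v = col_of (set u \<union> moved (set u) (set v))"

definition rcol :: "nat list \<Rightarrow> nat list \<Rightarrow> nat list" where
  "rcol u v = col_of (set v - moved (set u) (set v))"

lemma col_word_Nil [simp]: "col_word [] = []"
  by (simp add: col_word_def)

lemma Nil_col0 [simp]: "[] \<in> col0 n"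
  by (simp add: col0_def)

lemma col_iff: "u \<in> col n \<longleftrightarrow> u \<in> col0 n \<and> u \<noteq> []"
  by (auto simp: col_def col0_def)

lemma col_wordI: "u \<in> col0 n \<Longrightarrow> col_word u \<in> lists (col n)"
  by (simp add: col_word_def col_iff)

lemma col0_0: "u \<in> col0 n \<Longrightarrow> 0 \<notin> set u"
  by (auto simp: col0_def)

lemma rev_col0: "u \<in> col0 n \<longleftrightarrow> set u \<subseteq> {1..n} \<and> sorted_wrt (<) (rev u)"
  by (auto simp: col0_def sorted_wrt_rev)

lemma set_col_of [simp]: "finite A \<Longrightarrow> set (col_of A) = A"
  by (simp add: col_of_def)

lemma col_of_col0: "A \<subseteq> {1..n} \<Longrightarrow> col_of A \<in> col0 n"
  by (auto simp: rev_col0 col_of_def finite_subset)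

lemma col_of_set [simp]: "u \<in> col0 n \<Longrightarrow> col_of (set u) = u"
  unfolding col_of_def rev_col0
  using sorted_list_of_set.idem_if_sorted_distinct[of "rev u"] strict_sorted_iff[of "rev u"] by auto

lemma length_col0: "u \<in> col0 n \<Longrightarrow> length u = card (set u)"
  by (auto simp: rev_col0 strict_sorted_iff distinct_card)

lemma col0_eqI:
  assumes "u \<in> col0 n" "v \<in> col0 n" "\<And>m. cnt (set u) m = cnt (set v) m"
  shows "u = v"
  using cnt_inj[of "set u" "set v"] assms col_of_set col0_0 by metis

lemma finite_moved [simp]: "finite (moved (set u) (set v))"
  using moved_subset[of "set u" "set v"] by (auto intro: finite_subset)

lemma lcol_col0 [intro, simp]: "u \<in> col0 n \<Longrightarrow> v \<in> col0 n \<Longrightarrow> lcol u v \<in> col0 n"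
  unfolding lcol_def using moved_subset[of "set u" "set v"]
  by (intro col_of_col0) (auto simp: col0_def)

lemma rcol_col0 [intro, simp]: "u \<in> col0 n \<Longrightarrow> v \<in> col0 n \<Longrightarrow> rcol u v \<in> col0 n"
  unfolding rcol_def by (intro col_of_col0) (auto simp: col0_def)

lemma cnt_lcol:
  assumes "u \<in> col0 n" "v \<in> col0 n"
  shows "cnt (set (lcol u v)) = (\<lambda>m. cnt (set u) m + runmax (\<lambda>i. cnt (set v) i - cnt (set u) i) m)"
  using assms by (auto simp: lcol_def cnt_moved col0_0)

lemma cnt_rcol:
  assumes "u \<in> col0 n" "v \<in> col0 n"
  shows "cnt (set (rcol u v)) = (\<lambda>m. cnt (set v) m - runmax (\<lambda>i. cnt (set v) i - cnt (set u) i) m)"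
  using assms by (auto simp: rcol_def cnt_moved col0_0)

text \<open>A Galois connection, which translates entrywise comparison of columns into comparison of
  counts with the order reversed.\<close>

lemma less_length_filter_iff:
  fixes xs :: "nat list"
  assumes "sorted_wrt (<) xs"
  shows "i < length (filter (\<lambda>x. x \<le> m) xs) \<longleftrightarrow> i < length xs \<and> xs ! i \<le> m"
  using assms
proof (induction xs arbitrary: i)
  case (Cons x xs)
  show ?case
  proof (cases "x \<le> m")
    case True then show ?thesis using Cons by (cases i) auto
  next
    case False
    then have "filter (\<lambda>x. x \<le> m) xs = []" using Cons.prems by (auto simp: filter_empty_conv)
    moreover have "\<not> (x # xs) ! i \<le> m" if "i < length (x # xs)"
      using that False Cons.prems nth_mem by (cases i) fastforce+
    ultimately show ?thesis using False by auto
  qed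
qed simp

lemma cnt_eq_filter: "u \<in> col0 n \<Longrightarrow> cnt (set u) m = int (length (filter (\<lambda>x. x \<le> m) (rev u)))"
proof -
  assume u: "u \<in> col0 n"
  then have "distinct (filter (\<lambda>x. x \<le> m) (rev u))" by (simp add: rev_col0 strict_sorted_iff)
  from distinct_card[OF this] show ?thesis
    unfolding cnt_def by (metis Int_commute atMost_def inf_set_def mem_Collect_eq set_filter set_rev Collect_conj_eq Collect_mem_eq)
qed

lemma forms_tableau_iff_cnt:
  assumes "u \<in> col0 n" "v \<in> col0 n"
  shows "forms_tableau u v \<longleftrightarrow> (\<forall>m. cnt (set v) m \<le> cnt (set u) m)"
proof -
  let ?f = "\<lambda>w m. length (filter (\<lambda>x. x \<le> m) (rev w))"
  have u: "i < ?f u m \<longleftrightarrow> i < length u \<and> rev u ! i \<le> m" for i m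
    using less_length_filter_iff[of "rev u" i m] assms by (auto simp: rev_col0)
  have v: "i < ?f v m \<longleftrightarrow> i < length v \<and> rev v ! i \<le> m" for i m
    using less_length_filter_iff[of "rev v" i m] assms by (auto simp: rev_col0)
  have "forms_tableau u v \<longleftrightarrow> (\<forall>m. ?f v m \<le> ?f u m)"
  proof
    assume *: "forms_tableau u v"
    show "\<forall>m. ?f v m \<le> ?f u m"
    proof (intro allI leI notI)
      \<comment> \<open>The entry of \<open>v\<close> at index \<open>?f u m\<close> is at most
        \<open>m\<close>, hence so is that of \<open>u\<close>, which gives \<open>u\<close> one
        letter too many.\<close>
      fix m assume "?f u m < ?f v m"
      with v have "?f u m < length v" "rev v ! ?f u m \<le> m" by auto
      then have "?f u m < length u" "rev u ! ?f u m \<le> m"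
        using * unfolding forms_tableau_def by force+
      then show False using u[of "?f u m" m] by simp
    qed
  next
    assume *: "\<forall>m. ?f v m \<le> ?f u m"
    \<comment> \<open>The instance is \<open>m = rev v ! i\<close>. It also bounds the length, since
      every index of \<open>v\<close> becomes an index of \<open>u\<close>.\<close>
    have "i < length u \<and> rev u ! i \<le> rev v ! i" if "i < length v" for i
      using that u v * by (metis order.refl order_less_le_trans)
    then show "forms_tableau u v" unfolding forms_tableau_def by (metis linorder_not_less order_less_irrefl)
  qed
  then show ?thesis using cnt_eq_filter assms by simp
qed

text \<open>Without records the running maximum stays at its initial value 0, that is, the count of
  \<open>v\<close> never exceeds that of \<open>u\<close>.\<close>

lemma moved_empty_iff:
  assumes "u \<in> col0 n" "v \<in> col0 n"
  shows "moved (set u) (set v) = {} \<longleftrightarrow> forms_tableau u v"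
proof
  let ?f = "\<lambda>i. cnt (set v) i - cnt (set u) i"
  have 0: "?f 0 = 0" using assms by (simp add: cnt_0 col0_0)
  { assume *: "forms_tableau u v"
    have "\<not> Suc m \<in> moved (set u) (set v)" for m
      using * runmax_ge_0[of ?f m] 0 assms by (auto simp: Suc_in_moved_iff forms_tableau_iff_cnt not_less
          intro: order_trans[of _ 0])
    then show "moved (set u) (set v) = {}" using moved_subset col0_0[OF assms(2)]
      by (metis DiffD1 all_not_in_conv not0_implies_Suc subsetD) }
  { assume *: "moved (set u) (set v) = {}"
    have "runmax ?f m = 0" for m
    proof (induction m)
      case (Suc m)
      then show ?case using * Suc_in_moved_iff[of m "set u" "set v"] by simp
    qed (use 0 in simp)
    then show "forms_tableau u v"
      using runmax_ge[of ?f] assms by (auto simp: forms_tableau_iff_cnt) }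
qed

lemma lcol_rcol_tableau:
  assumes "u \<in> col0 n" "v \<in> col0 n" "forms_tableau u v"
  shows "lcol u v = u" "rcol u v = v"
  using assms moved_empty_iff[OF assms(1,2)] by (auto simp: lcol_def rcol_def)

lemma forms_tableau_Nil [simp]: "forms_tableau u []"
  by (simp add: forms_tableau_def)

lemma lcol_rcol_Nil_right [simp]:
  assumes "u \<in> col0 n" shows "lcol u [] = u" "rcol u [] = []"
  using lcol_rcol_tableau[OF assms Nil_col0] by auto

text \<open>A counting function is nondecreasing, hence its own running maximum, and all of
  \<open>v\<close> moves.\<close>

lemma lcol_rcol_Nil_left [simp]:
  assumes "v \<in> col0 n" shows "lcol [] v = v" "rcol [] v = []"
proof -
  have "runmax (\<lambda>i. cnt (set v) i) = cnt (set v)"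
    by (intro ext runmax_eqI) (auto simp: cnt_Suc)
  then have *: "cnt (set (lcol [] v)) = cnt (set v)" "cnt (set (rcol [] v)) = cnt {}"
    using cnt_lcol[OF Nil_col0 assms] cnt_rcol[OF Nil_col0 assms] by auto
  show "lcol [] v = v" using * assms by (intro col0_eqI[of _ n]) auto
  show "rcol [] v = []" using * assms by (intro col0_eqI[of _ n]) auto
qed

text \<open>In terms of counts the claim is \<open>v - g \<le> u + g\<close>, where the running
  maximum \<open>g\<close> of \<open>v - u\<close> is at least \<open>v - u\<close> and at least
  0.\<close>

lemma forms_tableau_lcol_rcol:
  assumes "u \<in> col0 n" "v \<in> col0 n"
  shows "forms_tableau (lcol u v) (rcol u v)"
proof -
  let ?f = "\<lambda>i. cnt (set v) i - cnt (set u) i"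
  have "?f 0 = 0" using assms by (simp add: cnt_0 col0_0)
  then have "?f m \<le> runmax ?f m + runmax ?f m" for m
    using runmax_ge[of ?f m] runmax_ge_0[of ?f m] by simp
  then have "\<forall>m. cnt (set (rcol u v)) m \<le> cnt (set (lcol u v)) m"
    unfolding cnt_lcol[OF assms] cnt_rcol[OF assms] by (smt (verit))
  then show ?thesis using assms by (subst forms_tableau_iff_cnt[of _ n]) auto
qed

section \<open>The braid relation for triples of columns\<close>

lemma rcol_braid:
  assumes "u \<in> col0 n" "v \<in> col0 n" "t \<in> col0 n"
  shows "rcol (rcol u (lcol v t)) (rcol v t) = rcol (rcol u v) t"
proof (rule col0_eqI)
  fix m
  let ?a = "\<lambda>i. cnt (set v) i - cnt (set u) i" and ?b = "\<lambda>i. cnt (set t) i - cnt (set v) i"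
  \<comment> \<open>Each side of the claim is the count of \<open>t\<close> minus one side of this
    identity.\<close>
  have "runmax (\<lambda>i. ?b i + runmax ?a i) m =
    runmax ?b m + runmax (\<lambda>i. ?b i - 2 * runmax ?b i + runmax (\<lambda>j. ?a j + runmax ?b j) i) m"
    by (rule runmax_braid) (auto simp: cnt_Suc)
  then show "cnt (set (rcol (rcol u (lcol v t)) (rcol v t))) m = cnt (set (rcol (rcol u v) t)) m"
    by (simp add: cnt_rcol[of _ n] cnt_lcol[of _ n] assms algebra_simps)
qed (use assms in auto)

text \<open>The same identity of running maxima as for \<open>rcol\<close>, with the two differences
  interchanged.\<close>

lemma lcol_braid:
  assumes "u \<in> col0 n" "v \<in> col0 n" "t \<in> col0 n"
  shows "lcol (lcol u v) (lcol (rcol u v) t) = lcol u (lcol v t)"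
proof (rule col0_eqI)
  fix m
  let ?a = "\<lambda>i. cnt (set t) i - cnt (set v) i" and ?b = "\<lambda>i. cnt (set v) i - cnt (set u) i"
  have "runmax (\<lambda>i. ?b i + runmax ?a i) m =
    runmax ?b m + runmax (\<lambda>i. ?b i - 2 * runmax ?b i + runmax (\<lambda>j. ?a j + runmax ?b j) i) m"
    by (rule runmax_braid) (auto simp: cnt_Suc)
  then show "cnt (set (lcol (lcol u v) (lcol (rcol u v) t))) m = cnt (set (lcol u (lcol v t))) m"
    by (simp add: cnt_rcol[of _ n] cnt_lcol[of _ n] assms algebra_simps)
qed (use assms in auto)

lemma cnt_lcol_rcol:
  assumes "u \<in> col0 n" "v \<in> col0 n"
  shows "cnt (set (lcol u v)) m + cnt (set (rcol u v)) m = cnt (set u) m + cnt (set v) m"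
  by (simp add: cnt_lcol[OF assms] cnt_rcol[OF assms])

text \<open>Each transform preserves the sum of the counts, so agreement of the outer columns forces
  agreement of the middle one.\<close>

lemma middle_braid:
  assumes "u \<in> col0 n" "v \<in> col0 n" "t \<in> col0 n"
  shows "lcol (rcol u (lcol v t)) (rcol v t) = rcol (lcol u v) (lcol (rcol u v) t)"
proof (rule col0_eqI)
  fix m
  let ?c = "\<lambda>w. cnt (set w) m"
  have "?c (lcol (lcol u v) (lcol (rcol u v) t)) + ?c (rcol (lcol u v) (lcol (rcol u v) t))
      + ?c (rcol (rcol u v) t) = ?c u + ?c v + ?c t"
    using assms cnt_lcol_rcol[of "lcol u v" n "lcol (rcol u v) t" m] cnt_lcol_rcol[of u n v m]
      cnt_lcol_rcol[of "rcol u v" n t m] by simp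
  moreover have "?c (lcol u (lcol v t)) + ?c (lcol (rcol u (lcol v t)) (rcol v t))
      + ?c (rcol (rcol u (lcol v t)) (rcol v t)) = ?c u + ?c v + ?c t"
    using assms cnt_lcol_rcol[of u n "lcol v t" m] cnt_lcol_rcol[of v n t m]
      cnt_lcol_rcol[of "rcol u (lcol v t)" n "rcol v t" m] by simp
  ultimately show "?c (lcol (rcol u (lcol v t)) (rcol v t)) = ?c (rcol (lcol u v) (lcol (rcol u v) t))"
    using lcol_braid[OF assms] rcol_braid[OF assms] by simp
qed (use assms in auto)

text \<open>The moved letters lie in \<open>v\<close> and outside \<open>u\<close>. The strict
  decrease on the right is the source of termination.\<close>

lemma length_lcol_rcol:
  assumes "u \<in> col0 n" "v \<in> col0 n"
  shows "length (lcol u v) + length (rcol u v) = length u + length v"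
    and "\<not> forms_tableau u v \<Longrightarrow> length (rcol u v) < length v"
proof -
  let ?M = "moved (set u) (set v)"
  have l: "length (lcol u v) = card (set u \<union> ?M)" and r: "length (rcol u v) = card (set v - ?M)"
    using assms by (auto simp: lcol_def rcol_def col_of_def)
  have M: "?M \<subseteq> set v" "?M \<inter> set u = {}" "finite ?M" using moved_subset[of "set u" "set v"]
    by (auto intro: finite_subset)
  have "card (set u \<union> ?M) = card (set u) + card ?M" "card (set v - ?M) = card (set v) - card ?M"
    "card ?M \<le> card (set v)"
    using M by (auto intro: card_Un_disjoint card_Diff_subset card_mono)
  then show "length (lcol u v) + length (rcol u v) = length u + length v"
    using l r length_col0[OF assms(1)] length_col0[OF assms(2)] by simp
  show "length (rcol u v) < length v" if "\<not> forms_tableau u v"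
  proof -
    have "?M \<noteq> {}" using that moved_empty_iff[OF assms] by simp
    then have "set v - ?M \<subset> set v" using M by auto
    then show ?thesis unfolding r length_col0[OF assms(2)] by (intro psubset_card_mono) auto
  qed
qed

text \<open>Below \<open>x\<close> the singleton contributes nothing, so every letter of
  \<open>u\<close> is a record and moves. This assembles columns letter by letter.\<close>

lemma lcol_rcol_Cons:
  assumes "x # u \<in> col0 n"
  shows "lcol [x] u = x # u" "rcol [x] u = []"
proof -
  have u: "\<forall>y\<in>set u. 0 < y \<and> y < x" "0 < x" using assms by (auto simp: col0_def Suc_le_eq)
  let ?f = "\<lambda>i. cnt (set u) i - cnt (set [x]) i"
  have eq: "runmax ?f k = cnt (set u) k" if "k < x" for k
    using that
  proof (induction k)
    case 0 then show ?case by (simp add: cnt_def)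
  next
    case (Suc k)
    have "cnt (set [x]) (Suc k) = 0" using Suc.prems by (simp add: cnt_def)
    then show ?case using Suc by (simp add: cnt_Suc)
  qed
  have "set u \<subseteq> moved (set [x]) (set u)"
  proof
    fix m assume m: "m \<in> set u"
    then obtain k where k: "m = Suc k" using u(1) gr0_conv_Suc by auto
    have "m < x" using m u by blast
    then have "cnt (set [x]) m = 0" by (simp add: cnt_def)
    then show "m \<in> moved (set [x]) (set u)"
      unfolding k Suc_in_moved_iff using eq[of k] \<open>m < x\<close> m k by (simp add: cnt_Suc)
  qed
  with moved_subset[of "set [x]" "set u"] have M: "moved (set [x]) (set u) = set u" by blast
  show "rcol [x] u = []" by (simp add: rcol_def M[simplified] col_of_def)
  show "lcol [x] u = x # u" using col_of_set[OF assms] by (simp add: lcol_def M[simplified])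
qed

text \<open>The words \<open>xzy\<close> and \<open>zxy\<close> group into the columns
  \<open>x, zy\<close> and \<open>zx, y\<close>. The difference first becomes positive at
  \<open>z\<close>, which is the letter that moves.\<close>

lemma lcol_rcol_knuth1:
  assumes "1 \<le> x" "x \<le> y" "y < z"
  shows "lcol [x] [z, y] = [z, x]" "rcol [x] [z, y] = [y]"
proof -
  have c: "[x] \<in> col0 z" "[y] \<in> col0 z" "[z, x] \<in> col0 z" "[z, y] \<in> col0 z"
    using assms by (auto simp: col0_def)
  let ?f = "\<lambda>i. cnt (set [z, y]) i - cnt (set [x]) i"
  have "runmax ?f = (\<lambda>m. if z \<le> m then 1 else 0)"
    using assms by (intro ext runmax_eqI) (auto simp: cnt_insert)
  with cnt_lcol[OF c(1,4)] cnt_rcol[OF c(1,4)]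
  have "cnt (set (lcol [x] [z, y])) m = cnt (set [z, x]) m" "cnt (set (rcol [x] [z, y])) m = cnt (set [y]) m" for m
    using assms by (auto simp: cnt_insert)
  then show "lcol [x] [z, y] = [z, x]" "rcol [x] [z, y] = [y]"
    using col0_eqI c by (meson lcol_col0 rcol_col0)+
qed

text \<open>The words \<open>yzx\<close> and \<open>yxz\<close> group into the columns
  \<open>y, zx\<close> and \<open>yx, z\<close>. Here the difference is positive already at
  \<open>x\<close>, which moves.\<close>

lemma lcol_rcol_knuth2:
  assumes "1 \<le> x" "x < y" "y \<le> z"
  shows "lcol [y] [z, x] = [y, x]" "rcol [y] [z, x] = [z]"
proof -
  have c: "[y] \<in> col0 z" "[z] \<in> col0 z" "[y, x] \<in> col0 z" "[z, x] \<in> col0 z"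
    using assms by (auto simp: col0_def)
  let ?f = "\<lambda>i. cnt (set [z, x]) i - cnt (set [y]) i"
  have "runmax ?f = (\<lambda>m. if x \<le> m then 1 else 0)"
    using assms by (intro ext runmax_eqI) (auto simp: cnt_insert)
  with cnt_lcol[OF c(1,4)] cnt_rcol[OF c(1,4)]
  have "cnt (set (lcol [y] [z, x])) m = cnt (set [y, x]) m" "cnt (set (rcol [y] [z, x])) m = cnt (set [z]) m" for m
    using assms by (auto simp: cnt_insert)
  then show "lcol [y] [z, x] = [y, x]" "rcol [y] [z, x] = [z]"
    using col0_eqI c by (meson lcol_col0 rcol_col0)+
qed


section \<open>The column presentation with Pitman transforms as relations\<close>

text \<open>The shape of \<open>X_src\<close>, with Pitman transforms in place of Schensted
  columns.\<close>

definition pitman_src :: "nat list \<times> nat list \<times> nat list \<Rightarrow> col_cell2" where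
  "pitman_src = (\<lambda>(u, v, t).
     let e = lcol u v; e' = rcol u v; b = lcol e' t; b' = rcol e' t
     in (alpha u v \<star>\<^sub>0 Id2 (col_word t))
        \<star>\<^sub>1 (Id2 (col_word e) \<star>\<^sub>0 alpha e' t)
        \<star>\<^sub>1 (alpha e b \<star>\<^sub>0 Id2 (col_word b')))"

definition pitman_tgt :: "nat list \<times> nat list \<times> nat list \<Rightarrow> col_cell2" where
  "pitman_tgt = (\<lambda>(u, v, t).
     let w = lcol v t; w' = rcol v t; a = lcol u w; a' = rcol u w
     in (Id2 (col_word u) \<star>\<^sub>0 alpha v t)
        \<star>\<^sub>1 (alpha u w \<star>\<^sub>0 Id2 (col_word w'))
        \<star>\<^sub>1 (Id2 (col_word a) \<star>\<^sub>0 alpha a' w'))"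

text \<open>Moving letters to the left decreases the sum of their column indices.\<close>

fun position_sum :: "nat list list \<Rightarrow> nat" where
  "position_sum [] = 0"
| "position_sum (c # cs) = position_sum cs + length (concat cs)"

lemma position_sum_append:
  "position_sum (x @ y) = position_sum x + position_sum y + length x * length (concat y)"
  by (induction x) auto

text \<open>Interpreted twice: first by a polygraph defined without Schensted insertion, in order to
  compute the columns of \<open>P(uv)\<close>, then by \<open>Col3 n\<close>. Targets and 3-cells
  are prescribed on generators only, because the two kinds of columns are compared only on
  columns.\<close>

locale pitman_polygraph =
  fixes S :: "(nat list, nat list \<times> nat list, nat list \<times> nat list \<times> nat list, 'z) polygraph31_scheme"
    and n :: nat
  assumes gens1: "gens1 S = col n"
    and gens2: "gens2 S = {(u, v). u \<in> col n \<and> v \<in> col n \<and> \<not> forms_tableau u v}"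
    and src2: "src2 S = (\<lambda>(u, v). [u, v])"
    and tgt2: "(u, v) \<in> gens2 S \<Longrightarrow> tgt2 S (u, v) = col_word (lcol u v) @ col_word (rcol u v)"
    and gens3: "gens3 S = {(u, v, t). u \<in> col n \<and> v \<in> col n \<and> t \<in> col n \<and>
      \<not> forms_tableau u v \<and> \<not> forms_tableau v t}"
    and src3: "X \<in> gens3 S \<Longrightarrow> src3 S X = pitman_src X"
    and tgt3: "X \<in> gens3 S \<Longrightarrow> tgt3 S X = pitman_tgt X"
begin

sublocale polygraph S
proof
  show "polygraph2 S"
    unfolding polygraph2_def
  proof
    fix \<alpha> assume a: "\<alpha> \<in> gens2 S"
    obtain u v where \<alpha>: "\<alpha> = (u, v)" by (cases \<alpha>)
    with a have "u \<in> col0 n" "v \<in> col0 n" by (auto simp: gens2 col_iff)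
    then have "tgt2 S \<alpha> \<in> lists (gens1 S)"
      using a col_wordI[OF lcol_col0] col_wordI[OF rcol_col0] unfolding \<alpha> gens1 tgt2[OF a[unfolded \<alpha>]]
      by simp
    with a show "src2 S \<alpha> \<in> lists (gens1 S) \<and> tgt2 S \<alpha> \<in> lists (gens1 S)"
      by (auto simp: \<alpha> gens1 gens2 src2)
  qed
qed

text \<open>In the identity cases the transform leaves the word unchanged, so one description of the
  boundary covers all pairs.\<close>

lemma alpha_cell:
  assumes "p \<in> col0 n" "q \<in> col0 n"
  shows "positive (alpha p q)" "dom2 S (alpha p q) = col_word p @ col_word q"
    "cod2 S (alpha p q) = col_word (lcol p q) @ col_word (rcol p q)"
proof -
  have w: "col_word p @ col_word q \<in> lists (gens1 S)"
    using assms col_wordI[of _ n] by (simp add: gens1)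
  show "positive (alpha p q)"
    using w assms by (auto simp: alpha_def gens2 col_iff simp del: append_in_lists_conv
        intro: positive.intros)
  show "dom2 S (alpha p q) = col_word p @ col_word q"
    by (auto simp: alpha_def src2 col_word_def)
  show "cod2 S (alpha p q) = col_word (lcol p q) @ col_word (rcol p q)"
    using assms lcol_rcol_tableau[OF assms] tgt2[of p q] by (auto simp: alpha_def gens2 col_iff)
qed

lemma alpha_cong:
  assumes "p \<in> col0 n" "q \<in> col0 n"
  shows "polygraph_cong S (col_word p @ col_word q) (col_word (lcol p q) @ col_word (rcol p q))"
proof (cases "p = [] \<or> q = [] \<or> forms_tableau p q")
  case True
  then have "col_word (lcol p q) @ col_word (rcol p q) = col_word p @ col_word q"
    using assms lcol_rcol_tableau[OF assms] by auto
  moreover have "col_word p @ col_word q \<in> lists (gens1 S)"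
    using col_wordI[OF assms(1)] col_wordI[OF assms(2)] by (simp add: gens1)
  ultimately show ?thesis by (simp add: polygraph_cong.refl del: in_lists_conv_set append_in_lists_conv)
next
  case False
  then show ?thesis using assms polygraph_cong.gen[of "(p, q)" S] tgt2[of p q]
    by (simp add: gens2 col_iff src2 col_word_def)
qed

text \<open>The three braid relations identify the columns of the two targets, which makes the cells
  parallel.\<close>

lemma pitman_cells:
  assumes "u \<in> col0 n" "v \<in> col0 n" "t \<in> col0 n"
  defines "z \<equiv> col_word (lcol u (lcol v t)) @ col_word (rcol (lcol u v) (lcol (rcol u v) t)) @
    col_word (rcol (rcol u v) t)"
  shows "hom2 S (pitman_src (u, v, t)) (col_word u @ col_word v @ col_word t) z"
    and "hom2 S (pitman_tgt (u, v, t)) (col_word u @ col_word v @ col_word t) z"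
  using assms(1-3) lcol_braid[OF assms(1-3)] rcol_braid[OF assms(1-3)] middle_braid[OF assms(1-3)]
  by (auto simp: hom2_iff pitman_src_def pitman_tgt_def Let_def alpha_cell positive_cell2 gens1 col_wordI z_def
      simp del: in_listsD)

text \<open>The critical branchings are the triples indexing \<open>gens3\<close>; each is filled by
  its generating 3-cell once the first step of either side is split off.\<close>

sublocale convergent_polygraph S position_sum
proof
  show "\<exists>u v. src2 S \<alpha> = [u, v]" if "\<alpha> \<in> gens2 S" for \<alpha>
    by (cases \<alpha>) (auto simp: src2)
  show "inj_on (src2 S) (gens2 S)"
    by (auto simp: inj_on_def src2)
  show "position_sum (p @ tgt2 S \<alpha> @ q) < position_sum (p @ src2 S \<alpha> @ q)"
    if a: "\<alpha> \<in> gens2 S" for \<alpha> p q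
  proof -
    obtain u v where \<alpha>: "\<alpha> = (u, v)" by (cases \<alpha>)
    with a have uv: "u \<in> col0 n" "v \<in> col0 n" "\<not> forms_tableau u v" by (auto simp: gens2 col_iff)
    let ?w = "lcol u v" and ?w' = "rcol u v"
    have len: "length ?w + length ?w' = length u + length v" "length ?w' < length v"
      using length_lcol_rcol[OF uv(1,2)] uv(3) by auto
    let ?x = "tgt2 S \<alpha>"
    have x: "?x = col_word ?w @ col_word ?w'" using tgt2 a \<alpha> by simp
    have 1: "length (concat ?x) = length u + length v" "length ?x \<le> 2"
      using len unfolding x by (auto simp: col_word_def)
    have 2: "position_sum ?x < length v"
      using len unfolding x by (auto simp: col_word_def)
    \<comment> \<open>The target has at most the two columns of the source, so letters to the right
      of the redex never move further right.\<close>
    have 3: "length ?x * k \<le> 2 * k" for k using 1(2) by simp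
    let ?r = "position_sum p + position_sum q + length p * (length u + length v + length (concat q))"
    have "position_sum (p @ ?x @ q) = ?r + position_sum ?x + length ?x * length (concat q)"
      using 1(1) by (simp add: position_sum_append)
    moreover have "position_sum (p @ src2 S \<alpha> @ q) = ?r + length v + 2 * length (concat q)"
      by (simp add: position_sum_append src2 \<alpha>)
    ultimately show ?thesis using 2 3[of "length (concat q)"] by linarith
  qed
  show "\<exists>f g. positive f \<and> positive g \<and>
      eqv S ((Gen2 \<alpha> \<star>\<^sub>0 Id2 [t]) \<star>\<^sub>1 f) ((Id2 [u] \<star>\<^sub>0 Gen2 \<beta>) \<star>\<^sub>1 g)"
    if ab: "\<alpha> \<in> gens2 S" "\<beta> \<in> gens2 S" "src2 S \<alpha> = [u, v]" "src2 S \<beta> = [v, t]" for \<alpha> \<beta> u v t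
  proof -
    have \<alpha>: "\<alpha> = (u, v)" and \<beta>: "\<beta> = (v, t)" using ab by (auto simp: src2 split: prod.splits)
    have X: "(u, v, t) \<in> gens3 S" using ab(1,2) by (auto simp: \<alpha> \<beta> gens2 gens3)
    have uvt: "u \<in> col0 n" "v \<in> col0 n" "t \<in> col0 n" "u \<noteq> []" "v \<noteq> []" "t \<noteq> []"
      "\<not> forms_tableau u v" "\<not> forms_tableau v t"
      using X by (auto simp: gens3 col_iff)
    let ?f = "(Id2 (col_word (lcol u v)) \<star>\<^sub>0 alpha (rcol u v) t)
        \<star>\<^sub>1 (alpha (lcol u v) (lcol (rcol u v) t) \<star>\<^sub>0 Id2 (col_word (rcol (rcol u v) t)))"
    let ?g = "(alpha u (lcol v t) \<star>\<^sub>0 Id2 (col_word (rcol v t)))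
        \<star>\<^sub>1 (Id2 (col_word (lcol u (lcol v t))) \<star>\<^sub>0 alpha (rcol u (lcol v t)) (rcol v t))"
    have "positive ?f" "positive ?g"
      by (intro positive.pos_Comp21 positive.pos_left positive.pos_right alpha_cell(1);
          simp add: uvt alpha_cell(2,3) gens1 col_wordI del: in_lists_conv_set)+
    moreover have "hom3 S (Gen3 (u, v, t)) (pitman_src (u, v, t)) (pitman_tgt (u, v, t))"
      using hom3.Gen3[OF X] src3[OF X] tgt3[OF X] by simp
    then have "eqv S (pitman_src (u, v, t)) (pitman_tgt (u, v, t))"
      using pitman_cells[OF uvt(1-3)] unfolding eqv_def hom2_iff by auto
    then have "eqv S ((Gen2 \<alpha> \<star>\<^sub>0 Id2 [t]) \<star>\<^sub>1 ?f) ((Id2 [u] \<star>\<^sub>0 Gen2 \<beta>) \<star>\<^sub>1 ?g)"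
      using uvt by (simp add: pitman_src_def pitman_tgt_def Let_def alpha_def[of u v] alpha_def[of v t]
          \<alpha> \<beta> col_word_def[of u] col_word_def[of t])
    ultimately show ?thesis by blast
  qed
qed

lemma polygraph31: "polygraph31 S"
  unfolding polygraph31_def
proof (intro conjI ballI)
  show "polygraph2 S" by (rule polygraph2)
  fix X assume X: "X \<in> gens3 S"
  obtain u v t where uvt: "X = (u, v, t)" by (cases X)
  with X show "\<exists>x y. hom2 S (src3 S X) x y \<and> hom2 S (tgt3 S X) x y"
    using pitman_cells[of u v t] by (auto simp: src3 tgt3) (auto simp: gens3 col_iff)
qed

section \<open>Normal forms and Knuth relations for column words\<close>

lemma successively_irreducible:
  assumes "x \<in> lists (col n)" "successively forms_tableau x"
  shows "irreducible_word x"
  using assms unfolding irreducible_word_def gens1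
  by (auto simp: successively_append_iff gens2 src2)

text \<open>The largest letter comes first and absorbs the rest of the column by one
  relation.\<close>

lemma letters_column:
  assumes "u \<in> col n"
  shows "polygraph_cong S (map (\<lambda>x. [x]) u) [u]"
  using assms
proof (induction u)
  case (Cons x u)
  show ?case
  proof (cases "u = []")
    case True
    then show ?thesis using Cons.prems by (auto intro!: polygraph_cong.refl simp: gens1)
  next
    case False
    have c: "x # u \<in> col0 n" "u \<in> col n" "[x] \<in> col0 n" "u \<in> col0 n"
      using Cons.prems False by (auto simp: col_iff col0_def)
    have "polygraph_cong S ([[x]] @ map (\<lambda>x. [x]) u) ([[x]] @ [u])"
      using Cons.IH c by (intro polygraph_cong.app polygraph_cong.refl) (auto simp: gens1 col_iff)
    moreover have "polygraph_cong S ([[x]] @ [u]) [x # u]"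
      using alpha_cong[OF c(3,4)] lcol_rcol_Cons[OF c(1)] False by (simp add: col_word_def)
    ultimately show ?thesis using polygraph_cong.trans by fastforce
  qed
qed (simp add: col_def)

text \<open>Each side of a Knuth relation groups into two columns, and one Pitman relation connects
  the two groupings.\<close>

lemma knuth_letters:
  assumes "polygraph_cong (knuth_polygraph n) w w'"
  shows "polygraph_cong S (map (\<lambda>x. [x]) w) (map (\<lambda>x. [x]) w')"
  using assms
proof (induction rule: polygraph_cong.induct)
  case (gen \<alpha>)
  have letter: "[x] \<in> col n" if "1 \<le> x" "x \<le> n" for x using that by (simp add: col_def)
  have refl1: "polygraph_cong S [[x]] [[x]]" if "1 \<le> x" "x \<le> n" for x
    using that by (auto intro!: polygraph_cong.refl simp: gens1 letter)
  have pair: "polygraph_cong S [[x], [y]] [[x, y]]" if "1 \<le> y" "y < x" "x \<le> n" for x y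
    using letters_column[of "[x, y]"] that by (simp add: col_def)
  from gen consider (1) x y z where "src2 (knuth_polygraph n) \<alpha> = [z, x, y]"
      "tgt2 (knuth_polygraph n) \<alpha> = [x, z, y]" "1 \<le> x" "x \<le> y" "y < z" "z \<le> n"
    | (2) x y z where "src2 (knuth_polygraph n) \<alpha> = [y, z, x]"
      "tgt2 (knuth_polygraph n) \<alpha> = [y, x, z]" "1 \<le> x" "x < y" "y \<le> z" "z \<le> n"
    by (auto simp: knuth_polygraph_def)
  then show ?case
  proof cases
    case 1
    have A: "polygraph_cong S [[z], [x], [y]] [[z, x], [y]]"
      using polygraph_cong.app[OF pair refl1, of x z y] 1 by simp
    have B: "polygraph_cong S [[x], [z], [y]] [[x], [z, y]]"
      using polygraph_cong.app[OF refl1 pair, of x y z] 1 by simp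
    have C: "polygraph_cong S [[x], [z, y]] [[z, x], [y]]"
      using alpha_cong[of "[x]" "[z, y]"] lcol_rcol_knuth1[of x y z] 1 by (simp add: col0_def col_word_def)
    show ?thesis
      using polygraph_cong.trans[OF A polygraph_cong.trans[OF polygraph_cong.sym[OF C] polygraph_cong.sym[OF B]]]
      by (simp add: 1(1,2))
  next
    case 2
    have A: "polygraph_cong S [[y], [z], [x]] [[y], [z, x]]"
      using polygraph_cong.app[OF refl1 pair, of y x z] 2 by simp
    have B: "polygraph_cong S [[y], [x], [z]] [[y, x], [z]]"
      using polygraph_cong.app[OF pair refl1, of x y z] 2 by simp
    have C: "polygraph_cong S [[y], [z, x]] [[y, x], [z]]"
      using alpha_cong[of "[y]" "[z, x]"] lcol_rcol_knuth2[of x y z] 2 by (simp add: col0_def col_word_def)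
    show ?thesis
      using polygraph_cong.trans[OF A polygraph_cong.trans[OF C polygraph_cong.sym[OF B]]]
      by (simp add: 2(1,2))
  qed
next
  case (refl x)
  then show ?case
    by (intro polygraph_cong.refl) (auto simp: gens1 knuth_polygraph_def col_def)
next
  case (sym x y) then show ?case by (blast intro: polygraph_cong.sym)
next
  case (trans x y z) then show ?case by (blast intro: polygraph_cong.trans)
next
  case (app x y x' y') then show ?case by (auto intro: polygraph_cong.app)
qed

lemma letters_concat:
  assumes "x \<in> lists (col n)"
  shows "polygraph_cong S (map (\<lambda>x. [x]) (concat x)) x"
  using assms
proof (induction x)
  case Nil then show ?case by (auto intro!: polygraph_cong.refl)
next
  case (Cons u x)
  then have "polygraph_cong S (map (\<lambda>x. [x]) u @ map (\<lambda>x. [x]) (concat x)) ([u] @ x)"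
    by (intro polygraph_cong.app letters_column) auto
  then show ?case by simp
qed

end


section \<open>Isomorphisms of presented monoids\<close>

lemma polygraph_cong_words:
  assumes "polygraph2 S" "polygraph_cong S x y"
  shows "x \<in> lists (gens1 S)" "y \<in> lists (gens1 S)"
  using assms(2,1) by (induction rule: polygraph_cong.induct) (auto simp: polygraph2_def)

lemma hom2_imp_polygraph_cong: "hom2 S f x y \<Longrightarrow> polygraph_cong S x y"
  by (induction rule: hom2.induct) (blast intro: polygraph_cong.intros)+

lemma cong_class_eq_iff:
  assumes "polygraph2 S" "x \<in> lists (gens1 S)"
  shows "cong_rel S `` {x} = cong_rel S `` {y} \<longleftrightarrow> polygraph_cong S x y"
proof
  have "x \<in> cong_rel S `` {x}" using polygraph_cong.refl[OF assms(2)] by (simp add: cong_rel_def)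
  then show "cong_rel S `` {x} = cong_rel S `` {y} \<Longrightarrow> polygraph_cong S x y"
    by (auto simp: cong_rel_def intro: polygraph_cong.sym)
  show "polygraph_cong S x y \<Longrightarrow> cong_rel S `` {x} = cong_rel S `` {y}"
    unfolding cong_rel_def by (auto intro: polygraph_cong.trans polygraph_cong.sym)
qed

text \<open>The union defining the product is constant, as congruence is compatible with
  concatenation.\<close>

lemma presented_mult:
  assumes "polygraph2 S" "x \<in> lists (gens1 S)" "y \<in> lists (gens1 S)"
  shows "cong_rel S `` {x} \<otimes>\<^bsub>presented_monoid S\<^esub> cong_rel S `` {y} = cong_rel S `` {x @ y}"
proof -
  have eq: "cong_rel S `` {x' @ y'} = cong_rel S `` {x @ y}"
    if "x' \<in> cong_rel S `` {x}" "y' \<in> cong_rel S `` {y}" for x' y'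
    using polygraph_cong.app[of S x x' y y'] that cong_class_eq_iff[OF assms(1), of "x @ y" "x' @ y'"] assms
    by (simp add: cong_rel_def)
  have "x \<in> cong_rel S `` {x}" "y \<in> cong_rel S `` {y}"
    using assms polygraph_cong.refl[of _ S] by (auto simp: cong_rel_def)
  then have "(\<Union>x'\<in>cong_rel S `` {x}. \<Union>y'\<in>cong_rel S `` {y}. cong_rel S `` {x @ y}) = cong_rel S `` {x @ y}"
    by blast
  then have "(\<Union>x'\<in>cong_rel S `` {x}. \<Union>y'\<in>cong_rel S `` {y}. cong_rel S `` {x' @ y'}) = cong_rel S `` {x @ y}"
    using eq by (simp cong: SUP_cong_simp)
  then show ?thesis by (simp add: presented_monoid_def)
qed

text \<open>\<open>\<phi>\<close> induces a multiplicative map of classes, and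
  \<open>\<psi>\<close>, its inverse up to congruence, makes this map bijective.\<close>

lemma presented_monoid_iso:
  assumes S: "polygraph2 S" and T: "polygraph2 T"
    and \<phi>_words: "\<And>x. x \<in> lists (gens1 S) \<Longrightarrow> \<phi> x \<in> lists (gens1 T)"
    and \<phi>_append: "\<And>x y. \<phi> (x @ y) = \<phi> x @ \<phi> y"
    and \<phi>: "\<And>x y. polygraph_cong S x y \<Longrightarrow> polygraph_cong T (\<phi> x) (\<phi> y)"
    and \<psi>: "\<And>x y. polygraph_cong T x y \<Longrightarrow> polygraph_cong S (\<psi> x) (\<psi> y)"
    and \<psi>\<phi>: "\<And>x. x \<in> lists (gens1 S) \<Longrightarrow> polygraph_cong S (\<psi> (\<phi> x)) x"
    and \<phi>\<psi>: "\<And>y. y \<in> lists (gens1 T) \<Longrightarrow> polygraph_cong T (\<phi> (\<psi> y)) y"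
  shows "presented_monoid S \<cong> presented_monoid T"
proof -
  \<comment> \<open>Saturating the image of a class avoids the choice of a representative.\<close>
  define h where "h X = cong_rel T `` (\<phi> ` X)" for X
  have h: "h (cong_rel S `` {x}) = cong_rel T `` {\<phi> x}" if x: "x \<in> lists (gens1 S)" for x
  proof -
    have "x \<in> cong_rel S `` {x}" using polygraph_cong.refl[OF x] by (simp add: cong_rel_def)
    then show ?thesis unfolding h_def cong_rel_def by (auto intro: \<phi> polygraph_cong.trans)
  qed
  let ?M = "presented_monoid S" and ?N = "presented_monoid T"
  have carrier: "carrier ?M = (\<lambda>x. cong_rel S `` {x}) ` lists (gens1 S)"
    "carrier ?N = (\<lambda>x. cong_rel T `` {x}) ` lists (gens1 T)"
    by (auto simp: presented_monoid_def quotient_def)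
  have "h \<in> hom ?M ?N"
  proof (rule homI)
    show "h X \<in> carrier ?N" if X: "X \<in> carrier ?M" for X
    proof -
      obtain x where "X = cong_rel S `` {x}" "x \<in> lists (gens1 S)" using X unfolding carrier by blast
      then show ?thesis using h \<phi>_words unfolding carrier by blast
    qed
    show "h (X \<otimes>\<^bsub>?M\<^esub> Y) = h X \<otimes>\<^bsub>?N\<^esub> h Y" if XY: "X \<in> carrier ?M" "Y \<in> carrier ?M" for X Y
    proof -
      obtain x y where "X = cong_rel S `` {x}" "x \<in> lists (gens1 S)" "Y = cong_rel S `` {y}" "y \<in> lists (gens1 S)"
        using XY unfolding carrier by blast
      then show ?thesis using \<phi>_words[of x] \<phi>_words[of y]
        by (simp add: presented_mult[OF S] presented_mult[OF T] h \<phi>_append del: in_lists_conv_set)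
    qed
  qed
  moreover have "bij_betw h (carrier ?M) (carrier ?N)"
    unfolding bij_betw_def
  proof
    show "inj_on h (carrier ?M)"
    proof (rule inj_onI)
      fix X Y assume XY: "X \<in> carrier ?M" "Y \<in> carrier ?M" "h X = h Y"
      obtain x y where x: "X = cong_rel S `` {x}" "x \<in> lists (gens1 S)"
        and y: "Y = cong_rel S `` {y}" "y \<in> lists (gens1 S)"
        using XY(1,2) unfolding carrier by blast
      have "polygraph_cong T (\<phi> x) (\<phi> y)"
        using XY(3) h x y cong_class_eq_iff[OF T \<phi>_words[OF x(2)]] by simp
      then have "polygraph_cong S x y"
        by (rule polygraph_cong.trans[OF polygraph_cong.sym[OF \<psi>\<phi>[OF x(2)]]
              polygraph_cong.trans[OF \<psi> \<psi>\<phi>[OF y(2)]]])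
      then show "X = Y" using x y cong_class_eq_iff[OF S x(2)] by simp
    qed
    show "h ` carrier ?M = carrier ?N"
    proof
      show "h ` carrier ?M \<subseteq> carrier ?N"
        using \<open>h \<in> hom ?M ?N\<close> by (auto simp: hom_def)
      show "carrier ?N \<subseteq> h ` carrier ?M"
      proof
        fix Y assume "Y \<in> carrier ?N"
        then obtain y where y: "Y = cong_rel T `` {y}" "y \<in> lists (gens1 T)" unfolding carrier by blast
        have "\<psi> y \<in> lists (gens1 S)"
          using polygraph_cong_words[OF S \<psi>[OF polygraph_cong.refl[OF y(2)]]] by simp
        moreover have "Y = h (cong_rel S `` {\<psi> y})"
          using cong_class_eq_iff[OF T \<phi>_words[OF calculation], of y] \<phi>\<psi>[OF y(2)] y h[OF calculation]
          by blast
        ultimately show "Y \<in> h ` carrier ?M" unfolding carrier by blast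
      qed
    qed
  qed
  ultimately show ?thesis unfolding is_iso_def iso_def by blast
qed


section \<open>Schensted insertion and Knuth equivalence\<close>

abbreviation knuth_cong :: "nat \<Rightarrow> nat list \<Rightarrow> nat list \<Rightarrow> bool" where
  "knuth_cong n \<equiv> polygraph_cong (knuth_polygraph n)"

lemma polygraph2_knuth: "polygraph2 (knuth_polygraph n)"
  by (auto simp: polygraph2_def knuth_polygraph_def)

lemma knuth_refl: "set w \<subseteq> {1..n} \<Longrightarrow> knuth_cong n w w"
  by (intro polygraph_cong.refl) (auto simp: knuth_polygraph_def)

lemmas knuth_trans [trans] = polygraph_cong.trans[of "knuth_polygraph n" for n]
lemmas knuth_sym = polygraph_cong.sym[of "knuth_polygraph n" for n]

lemma knuth_context:
  assumes "knuth_cong n w w'" "set p \<subseteq> {1..n}" "set q \<subseteq> {1..n}"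
  shows "knuth_cong n (p @ w @ q) (p @ w' @ q)"
  using assms by (intro polygraph_cong.app knuth_refl)

lemma knuth1: "1 \<le> x \<Longrightarrow> x \<le> y \<Longrightarrow> y < z \<Longrightarrow> z \<le> n \<Longrightarrow> knuth_cong n [z, x, y] [x, z, y]"
  using polygraph_cong.gen[of "([z, x, y], [x, z, y])" "knuth_polygraph n"] by (simp add: knuth_polygraph_def)

lemma knuth2: "1 \<le> x \<Longrightarrow> x < y \<Longrightarrow> y \<le> z \<Longrightarrow> z \<le> n \<Longrightarrow> knuth_cong n [y, z, x] [y, x, z]"
  using polygraph_cong.gen[of "([y, z, x], [y, x, z])" "knuth_polygraph n"] by (simp add: knuth_polygraph_def)

section \<open>Row insertion as a sequence of Knuth moves\<close>

lemma knuth_move_inserted: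
  assumes "sorted (x # b)" "y < x" "set (x # b) \<subseteq> {1..n}" "1 \<le> y"
  shows "knuth_cong n (x # b @ [y]) (x # y # b)"
  using assms
proof (induction b rule: rev_induct)
  case Nil
  then show ?case by (auto intro!: knuth_refl)
next
  case (snoc c b)
  \<comment> \<open>\<open>d\<close> precedes \<open>c\<close> and exceeds \<open>y\<close>, so
    \<open>yzx = yxz\<close>, read on \<open>d\<close>, \<open>c\<close>, \<open>y\<close>, lets
    \<open>y\<close> pass \<open>c\<close>. The bumped letter \<open>x\<close> guarantees that such
    a \<open>d\<close> exists.\<close>
  obtain p d where pd: "x # b = p @ [d]" by (metis append_butlast_last_id list.distinct(1))
  have "d \<in> set (x # b)" unfolding pd by simp
  then have d: "y < d" "d \<le> c" "c \<le> n" using snoc.prems by (auto simp: sorted_append)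
  have p: "set p \<subseteq> {1..n}" using snoc.prems(3) pd by (metis Un_subset_iff append_Cons set_append)
  have "knuth_cong n (p @ [d, c, y] @ []) (p @ [d, y, c] @ [])"
    using d p snoc.prems by (intro knuth_context knuth2) auto
  then have "knuth_cong n (x # b @ [c, y]) (x # b @ [y, c])"
    using pd by (metis append.assoc append_Cons append_Nil append_Nil2)
  also have "knuth_cong n ((x # b @ [y]) @ [c]) ((x # y # b) @ [c])"
    using snoc by (intro polygraph_cong.app knuth_refl) (auto simp: sorted_append)
  then have "knuth_cong n (x # b @ [y, c]) (x # y # b @ [c])" by simp
  finally show ?case by simp
qed

text \<open>The bumped letter \<open>x\<close> travels left by \<open>zxy = xzy\<close>. Once it has
  passed \<open>c\<close>, that letter takes over the role of \<open>y\<close>, hence the induction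
  for arbitrary \<open>y\<close>.\<close>

lemma knuth_move_bumped:
  assumes "sorted a" "\<And>c. c \<in> set a \<Longrightarrow> c \<le> y" "y < x" "set a \<subseteq> {1..n}" "x \<le> n" "1 \<le> y"
  shows "knuth_cong n (a @ [x, y]) (x # a @ [y])"
  using assms
proof (induction a arbitrary: y rule: rev_induct)
  case Nil
  then show ?case by (auto intro!: knuth_refl)
next
  case (snoc c a)
  have c: "1 \<le> c" "c \<le> y" "\<And>d. d \<in> set a \<Longrightarrow> d \<le> c" "sorted a"
    using snoc.prems by (auto simp: sorted_append)
  have "c < x" using c(2) snoc.prems(3) by simp
  have "knuth_cong n (a @ [c, x, y] @ []) (a @ [x, c, y] @ [])"
    using c snoc.prems by (intro knuth_context knuth_sym[OF knuth1]) auto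
  also have "knuth_cong n ((a @ [x, c]) @ [y]) ((x # a @ [c]) @ [y])"
    using c \<open>c < x\<close> snoc.prems by (intro polygraph_cong.app snoc.IH knuth_refl) auto
  then have "knuth_cong n (a @ [x, c, y] @ []) (x # a @ [c, y])" by simp
  finally show ?case by simp
qed

text \<open>The index \<open>j\<close> of \<open>insert_letter\<close>.\<close>

definition bump_pos :: "nat list \<Rightarrow> nat \<Rightarrow> nat" where
  "bump_pos r y = length (takeWhile (\<lambda>x. x \<le> y) r)"

lemma bump_pos:
  assumes "sorted r" "\<not> sorted (r @ [y])"
  shows "bump_pos r y < length r" "y < r ! bump_pos r y" "\<And>i. i < bump_pos r y \<Longrightarrow> r ! i \<le> y"
    "\<And>i. bump_pos r y \<le> i \<Longrightarrow> i < length r \<Longrightarrow> y < r ! i"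
proof -
  have "\<not> (\<forall>x\<in>set r. x \<le> y)" using assms by (auto simp: sorted_append)
  then have "takeWhile (\<lambda>x. x \<le> y) r \<noteq> r" by (simp add: takeWhile_eq_all_conv)
  then show 1: "bump_pos r y < length r"
    unfolding bump_pos_def by (metis length_takeWhile_le le_neq_implies_less takeWhile_eq_take take_all_iff order_refl)
  then show 2: "y < r ! bump_pos r y"
    unfolding bump_pos_def using nth_length_takeWhile[of "\<lambda>x. x \<le> y" r] by simp
  show "r ! i \<le> y" if "i < bump_pos r y" for i
    using that nth_mem[of i "takeWhile (\<lambda>x. x \<le> y) r"] unfolding bump_pos_def
    by (metis set_takeWhileD takeWhile_nth)
  show "y < r ! i" if "bump_pos r y \<le> i" "i < length r" for i
    using 2 sorted_nth_mono[OF assms(1) that] by simp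
qed

lemma insert_letter_bump:
  "\<not> sorted (r @ [y]) \<Longrightarrow>
    insert_letter (r # Y) y = r[bump_pos r y := y] # insert_letter Y (r ! bump_pos r y)"
  by (simp add: bump_pos_def Let_def)

text \<open>First the inserted letter moves left to the place after the bumped one, then the bumped
  letter moves to the front of the row.\<close>

lemma knuth_row_insert:
  assumes r: "sorted r" "\<not> sorted (r @ [y])" "set r \<subseteq> {1..n}" "1 \<le> y"
  defines "j \<equiv> bump_pos r y"
  shows "knuth_cong n (r @ [y]) (r ! j # r[j := y])"
proof -
  note j = bump_pos[OF r(1,2), folded j_def]
  let ?a = "take j r" and ?x = "r ! j" and ?b = "drop (Suc j) r"
  have split: "r = ?a @ ?x # ?b" using j(1) by (rule id_take_nth_drop)
  have sub: "set ?a \<subseteq> {1..n}" "set ?b \<subseteq> {1..n}" and x: "?x \<in> {1..n}"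
    using r(3) set_take_subset[of j r] set_drop_subset[of "Suc j" r] nth_mem[OF j(1)] by blast+
  have x': "1 \<le> ?x" "?x \<le> n" using x by simp_all
  have sorted: "sorted ?a" "sorted (?x # ?b)"
    using r(1) split sorted_append by metis+
  have "knuth_cong n (?a @ (?x # ?b @ [y]) @ []) (?a @ (?x # y # ?b) @ [])"
    using sub x' sorted j(1-3) r(4) by (intro knuth_context knuth_move_inserted) auto
  also have "knuth_cong n ([] @ (?a @ [?x, y]) @ ?b) ([] @ (?x # ?a @ [y]) @ ?b)"
    using sub x' sorted j(1-3) r(4)
    by (intro knuth_context knuth_move_bumped) (auto simp: in_set_conv_nth)
  then have "knuth_cong n (?a @ (?x # y # ?b) @ []) (?x # ?a @ y # ?b)" by simp
  finally have "knuth_cong n ((?a @ ?x # ?b) @ [y]) (?x # ?a @ y # ?b)" by simp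
  then show ?thesis using j(1) split by (simp add: upd_conv_take_nth_drop)
qed

text \<open>The bumped letter in front of its row stands at the end of the reading word of the
  remaining rows, where the induction inserts it.\<close>

lemma knuth_insert_letter:
  assumes "\<forall>r\<in>set Y. sorted r" "\<forall>r\<in>set Y. set r \<subseteq> {1..n}" "1 \<le> y" "y \<le> n"
  shows "knuth_cong n (concat (rev Y) @ [y]) (concat (rev (insert_letter Y y)))"
  using assms
proof (induction Y arbitrary: y)
  case Nil
  then show ?case by (auto intro!: knuth_refl)
next
  case (Cons r Y)
  show ?case
  proof (cases "sorted (r @ [y])")
    case True
    then show ?thesis using Cons.prems by (fastforce intro!: knuth_refl)
  next
    case False
    let ?j = "bump_pos r y"
    have j: "?j < length r" using bump_pos[of r y] False Cons.prems by simp
    have x: "1 \<le> r ! ?j" "r ! ?j \<le> n" using nth_mem[OF j] Cons.prems by auto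
    have upd: "set (r[?j := y]) \<subseteq> {1..n}"
      using Cons.prems set_update_subset_insert[of r ?j y] by fastforce
    have "knuth_cong n (concat (rev Y) @ (r @ [y])) (concat (rev Y) @ (r ! ?j # r[?j := y]))"
      using False Cons.prems by (intro polygraph_cong.app knuth_row_insert knuth_refl) auto
    also have "knuth_cong n ((concat (rev Y) @ [r ! ?j]) @ r[?j := y])
        (concat (rev (insert_letter Y (r ! ?j))) @ r[?j := y])"
      using Cons.prems x upd by (intro polygraph_cong.app Cons.IH knuth_refl) auto
    then have "knuth_cong n (concat (rev Y) @ (r ! ?j # r[?j := y]))
        (concat (rev (insert_letter Y (r ! ?j))) @ r[?j := y])" by simp
    finally show ?thesis using insert_letter_bump[OF False, of Y] by simp
  qed
qed

lemma set_insert_letter: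
  "\<forall>r\<in>set Y. sorted r \<Longrightarrow> set (concat (insert_letter Y y)) \<subseteq> insert y (set (concat Y))"
proof (induction Y arbitrary: y)
  case (Cons r Y)
  show ?case
  proof (cases "sorted (r @ [y])")
    case False
    then have j: "bump_pos r y < length r" using bump_pos[of r y] Cons.prems by simp
    show ?thesis
      using Cons.IH[of "r ! bump_pos r y"] Cons.prems set_update_subset_insert[of r "bump_pos r y" y]
        nth_mem[OF j]
      unfolding insert_letter_bump[OF False] by (simp del: insert_letter.simps) blast
  qed auto
qed simp

section \<open>Insertion preserves tableaux\<close>

definition dominates :: "nat list \<Rightarrow> nat list \<Rightarrow> bool" where
  "dominates s r \<longleftrightarrow> length s \<le> length r \<and> (\<forall>i<length s. r ! i < s ! i)"

primrec tableau :: "nat list list \<Rightarrow> bool" where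
  "tableau [] \<longleftrightarrow> True"
| "tableau (r # Y) \<longleftrightarrow> r \<noteq> [] \<and> sorted r \<and> (Y \<noteq> [] \<longrightarrow> dominates (hd Y) r) \<and> tableau Y"

lemma sorted_bump:
  assumes "sorted r" "\<not> sorted (r @ [y])"
  shows "sorted (r[bump_pos r y := y])"
  unfolding sorted_iff_nth_mono
proof (intro allI impI)
  fix i k assume "i \<le> k" "k < length (r[bump_pos r y := y])"
  then show "r[bump_pos r y := y] ! i \<le> r[bump_pos r y := y] ! k"
    using bump_pos[OF assms] sorted_nth_mono[OF assms(1), of i k]
    by (auto simp: nth_list_update not_less less_imp_le nat_neq_iff split: if_splits)
qed

lemma insert_letter_not_Nil [simp]: "insert_letter Y y \<noteq> []"
  by (cases Y) (auto simp: Let_def)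

text \<open>Bumping moves weakly left: if the next row reaches column \<open>?j\<close>, its entry
  there already exceeds \<open>?x\<close>. So \<open>?x\<close> settles at an index of at most
  \<open>?j\<close>, where the updated row \<open>?r'\<close> has a smaller entry.\<close>

lemma dominates_bump:
  assumes r: "sorted r" "\<not> sorted (r @ [y])"
    and Y: "Y \<noteq> [] \<longrightarrow> dominates (hd Y) r" "tableau Y"
  shows "dominates (hd (insert_letter Y (r ! bump_pos r y))) (r[bump_pos r y := y])"
proof -
  let ?j = "bump_pos r y"
  let ?x = "r ! ?j" and ?r' = "r[?j := y]"
  note j = bump_pos[OF r]
  have r': "?r' ! i \<le> r ! i" "i \<le> ?j \<Longrightarrow> ?r' ! i < ?x" if "i < length r" for i
    using j(1,2) j(3)[of i] that by (cases "i = ?j"; force)+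
  show ?thesis
  proof (cases Y)
    case Nil
    have "0 < length r" using j(1) by linarith
    then show ?thesis using Nil r'(2)[of 0] by (simp add: dominates_def Suc_le_eq)
  next
    case (Cons s Y')
    then have s: "sorted s" "length s \<le> length r" "\<And>i. i < length s \<Longrightarrow> r ! i < s ! i"
      using Y by (auto simp: dominates_def)
    show ?thesis
    proof (cases "sorted (s @ [?x])")
      case True
      have "length s \<le> ?j"
      proof (rule ccontr)
        assume "\<not> length s \<le> ?j"
        then have "?x < s ! ?j" "s ! ?j \<in> set s" using s(3) by auto
        then show False using True by (auto simp: sorted_append)
      qed
      moreover have "hd (insert_letter Y ?x) = s @ [?x]" using Cons True by simp
      ultimately show ?thesis using s j(1) r' unfolding dominates_def
        by (auto simp: nth_append less_Suc_eq intro: le_less_trans)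
    next
      case False
      let ?k = "bump_pos s ?x"
      note k = bump_pos[OF s(1) False]
      have "?k \<le> ?j"
      proof (rule ccontr)
        assume "\<not> ?k \<le> ?j"
        then show False using k(1) k(3)[of ?j] s(3)[of ?j] by simp
      qed
      moreover have "hd (insert_letter Y ?x) = s[?k := ?x]"
        using Cons insert_letter_bump[OF False] by simp
      ultimately show ?thesis using s k(1) r' unfolding dominates_def
        by (auto simp: nth_list_update intro: le_less_trans less_le_trans)
    qed
  qed
qed

lemma tableau_insert_letter: "tableau Y \<Longrightarrow> tableau (insert_letter Y y)"
proof (induction Y arbitrary: y)
  case (Cons r Y)
  show ?case
  proof (cases "sorted (r @ [y])")
    case True
    then show ?thesis using Cons.prems by (auto simp: dominates_def nth_append)
  next
    case False
    then show ?thesis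
      using Cons sorted_bump[of r y] dominates_bump[of r y Y] by (simp add: insert_letter_bump del: insert_letter.simps)
  qed
qed simp

lemma schensted_snoc: "schensted (w @ [y]) = insert_letter (schensted w) y"
  by (simp add: schensted_def)

lemma tableau_schensted: "tableau (schensted w)"
  by (induction w rule: rev_induct) (auto simp: schensted_snoc tableau_insert_letter, simp add: schensted_def)

lemma tableau_rows: "tableau Y \<Longrightarrow> r \<in> set Y \<Longrightarrow> sorted r \<and> r \<noteq> []"
  by (induction Y) auto

lemma set_schensted: "set (concat (schensted w)) \<subseteq> set w"
proof (induction w rule: rev_induct)
  case (snoc y w)
  then show ?case using set_insert_letter[of "schensted w" y] tableau_rows[OF tableau_schensted[of w]]
    unfolding schensted_snoc by fastforce
qed (simp add: schensted_def)

lemma knuth_schensted: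
  assumes "set w \<subseteq> {1..n}"
  shows "knuth_cong n w (concat (rev (schensted w)))"
  using assms
proof (induction w rule: rev_induct)
  case Nil
  then show ?case by (auto intro!: knuth_refl simp: schensted_def)
next
  case (snoc y w)
  have "knuth_cong n (w @ [y]) (concat (rev (schensted w)) @ [y])"
    using snoc by (intro polygraph_cong.app knuth_refl) auto
  also have "knuth_cong n \<dots> (concat (rev (insert_letter (schensted w) y)))"
    using snoc.prems tableau_rows[OF tableau_schensted[of w]] set_schensted[of w]
    by (intro knuth_insert_letter) fastforce+
  finally show ?case by (simp add: schensted_snoc)
qed


section \<open>Columns of tableaux\<close>

definition column :: "nat list list \<Rightarrow> nat \<Rightarrow> nat list" where
  "column Y i = [r ! i. r \<leftarrow> rev Y, i < length r]"

definition columns :: "nat list list \<Rightarrow> nat list list" where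
  "columns Y = map (column Y) [0..<(if Y = [] then 0 else length (hd Y))]"

lemma tab_col_eq: "tab_col w i = column (schensted w) i"
  by (simp add: tab_col_def column_def)

lemma tab_cols_eq: "tab_cols w = columns (schensted w)"
  by (auto simp: tab_cols_def columns_def tab_col_eq)

lemma column_Nil [simp]: "column [] i = []"
  by (simp add: column_def)

lemma column_Cons [simp]: "column (r # Y) i = column Y i @ (if i < length r then [r ! i] else [])"
  by (simp add: column_def)

lemma set_column: "set (column Y i) \<subseteq> set (concat Y)"
  by (induction Y) auto

lemma column_beyond: "tableau Y \<Longrightarrow> Y \<noteq> [] \<Longrightarrow> length (hd Y) \<le> i \<Longrightarrow> column Y i = []"
proof (induction Y)
  case (Cons r Y)
  then show ?case by (cases "Y = []") (auto simp: dominates_def)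
qed simp

text \<open>The lower bound by the head row is carried along because it lets the entry of a further
  row be appended.\<close>

lemma column_decreasing:
  "tableau Y \<Longrightarrow> sorted_wrt (>) (column Y i) \<and>
    (\<forall>x\<in>set (column Y i). i < length (hd Y) \<and> hd Y ! i \<le> x)"
proof (induction Y)
  case (Cons r Y)
  then have IH: "sorted_wrt (>) (column Y i)"
    "\<And>x. x \<in> set (column Y i) \<Longrightarrow> i < length (hd Y) \<and> hd Y ! i \<le> x" by auto
  have "i < length r \<and> r ! i < x" if "x \<in> set (column Y i)" for x
  proof -
    have "Y \<noteq> []" using that by auto
    then have "dominates (hd Y) r" using Cons.prems by simp
    then show ?thesis using IH(2)[OF that] unfolding dominates_def by fastforce
  qed
  with IH(1) show ?case by (fastforce simp: sorted_wrt_append)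
qed simp

lemma column_greater:
  assumes "tableau (r # Y)" "x \<in> set (column Y i)"
  shows "r ! i < x"
proof -
  have "Y \<noteq> []" using assms by auto
  then show ?thesis using assms column_decreasing[of Y i] by (fastforce simp: dominates_def)
qed

lemma forms_tableau_snoc:
  assumes "forms_tableau c d" "x \<le> y"
  shows "forms_tableau (c @ [x]) (d @ [y])"
  using assms unfolding forms_tableau_def by (auto simp: nth_Cons split: nat.splits)

text \<open>A row reaching both columns extends the comparison by one entry; if it misses the right
  column, that column is empty, since the remaining rows are no longer.\<close>

lemma forms_tableau_column: "tableau Y \<Longrightarrow> forms_tableau (column Y i) (column Y (Suc i))"
proof (induction Y)
  case (Cons r Y)
  show ?case
  proof (cases "Suc i < length r")
    case True
    then have "r ! i \<le> r ! Suc i" using Cons.prems by (auto intro: sorted_nth_mono)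
    then show ?thesis using Cons True by (auto intro: forms_tableau_snoc)
  next
    case False
    then have "column (r # Y) (Suc i) = []"
      using Cons.prems by (intro column_beyond) auto
    then show ?thesis by simp
  qed
qed simp

lemma successively_columns: "tableau Y \<Longrightarrow> successively forms_tableau (columns Y)"
  by (simp add: successively_conv_nth columns_def forms_tableau_column)

lemma columns_col:
  assumes "tableau Y" "set (concat Y) \<subseteq> {1..n}"
  shows "columns Y \<in> lists (col n)"
proof -
  have "column Y i \<in> col n" if "Y \<noteq> []" "i < length (hd Y)" for i
  proof -
    have "column Y i \<noteq> []" using that by (cases Y) auto
    then show ?thesis
      using column_decreasing[OF assms(1), of i] set_column[of Y i] assms(2) unfolding col_def by blast
  qed
  then show ?thesis by (auto simp: columns_def)
qed

section \<open>Row reading versus column reading\<close>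

lemma knuth_pass_column1:
  assumes "sorted_wrt (>) c" "\<And>d. d \<in> set c \<Longrightarrow> x < d" "1 \<le> a" "a \<le> x" "x \<le> n" "set c \<subseteq> {1..n}"
  shows "knuth_cong n (c @ [a, x]) (a # c @ [x])"
  using assms
proof (induction c)
  case Nil
  then show ?case by (auto intro!: knuth_refl)
next
  case (Cons d c)
  \<comment> \<open>\<open>e\<close> is the letter that follows once \<open>a\<close> has passed
    \<open>c\<close>; \<open>a \<le> e < d\<close> is the situation of
    \<open>zxy = xzy\<close>.\<close>
  obtain e q where eq: "c @ [x] = e # q" by (cases "c @ [x]") auto
  have "set (e # q) \<subseteq> {1..n}" using Cons.prems unfolding eq[symmetric] by auto
  then have q: "set q \<subseteq> {1..n}" by simp
  have "e \<in> set (c @ [x])" unfolding eq by simp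
  then have e: "a \<le> e" "e < d" using Cons.prems by fastforce+
  have "knuth_cong n ([d] @ (c @ [a, x])) ([d] @ (a # c @ [x]))"
    using Cons by (intro polygraph_cong.app knuth_refl Cons.IH) auto
  also have "knuth_cong n ([] @ [d, a, e] @ q) ([] @ [a, d, e] @ q)"
    using e q Cons.prems by (intro knuth_context knuth1) auto
  then have "knuth_cong n ([d] @ (a # c @ [x])) (a # d # c @ [x])" by (simp add: eq)
  finally show ?case by simp
qed

text \<open>The letters of \<open>a\<close> pass the column one by one, each with its successor in
  the row as the witness on the right.\<close>

lemma knuth_pass_column:
  assumes "sorted_wrt (>) c" "\<And>d. d \<in> set c \<Longrightarrow> x < d" "sorted (a @ [x])" "set (a @ [x]) \<subseteq> {1..n}"
    "set c \<subseteq> {1..n}"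
  shows "knuth_cong n (c @ a @ [x]) (a @ c @ [x])"
  using assms
proof (induction a)
  case Nil
  then show ?case by (auto intro!: knuth_refl)
next
  case (Cons b a)
  obtain e q where eq: "a @ [x] = e # q" by (cases "a @ [x]") auto
  have "set (e # q) \<subseteq> {1..n}" using Cons.prems(4) unfolding eq[symmetric] by auto
  then have q: "set q \<subseteq> {1..n}" by simp
  have "e \<in> set (a @ [x])" unfolding eq by simp
  then have e: "b \<le> e" "e \<le> x" "e \<le> n" using Cons.prems by (auto simp: sorted_append)
  have "knuth_cong n ([] @ (c @ [b, e]) @ q) ([] @ (b # c @ [e]) @ q)"
    using e q Cons.prems by (intro knuth_context knuth_pass_column1) (auto intro: le_less_trans)
  then have "knuth_cong n (c @ (b # a) @ [x]) (b # c @ a @ [x])" by (simp add: eq)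
  also have "knuth_cong n ([b] @ (c @ a @ [x])) ([b] @ (a @ c @ [x]))"
    using Cons by (intro polygraph_cong.app knuth_refl Cons.IH) auto
  then have "knuth_cong n (b # c @ a @ [x]) ((b # a) @ c @ [x])" by simp
  finally show ?case .
qed

text \<open>Induction from the last column: all entries of the row but the last pass it, and the
  last one becomes its top entry.\<close>

lemma knuth_add_row:
  assumes "length C = length r" "sorted r" "set r \<subseteq> {1..n}" "set (concat C) \<subseteq> {1..n}"
    "\<And>i. i < length C \<Longrightarrow> sorted_wrt (>) (C ! i @ [r ! i])"
  shows "knuth_cong n (concat C @ r) (concat (map (\<lambda>i. C ! i @ [r ! i]) [0..<length C]))"
  using assms
proof (induction C arbitrary: r rule: rev_induct)
  case Nil
  then show ?case by (auto intro!: knuth_refl)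
next
  case (snoc c C)
  then obtain a x where r: "r = a @ [x]" "length a = length C"
    by (metis length_append_singleton length_Suc_conv_rev)
  have c: "sorted_wrt (>) (c @ [x])" using snoc.prems(5)[of "length C"] r by (simp add: nth_append)
  have C: "sorted_wrt (>) (C ! i @ [a ! i])" if "i < length C" for i
    using snoc.prems(5)[of i] r that by (simp add: nth_append)
  have "knuth_cong n (concat C @ (c @ a @ [x])) (concat C @ (a @ c @ [x]))"
    using c snoc.prems r by (intro polygraph_cong.app knuth_refl knuth_pass_column) (auto simp: sorted_wrt_append)
  also have "knuth_cong n ((concat C @ a) @ (c @ [x]))
      (concat (map (\<lambda>i. C ! i @ [a ! i]) [0..<length C]) @ (c @ [x]))"
    using C snoc.prems r by (intro polygraph_cong.app knuth_refl snoc.IH) (auto simp: sorted_append)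
  then have "knuth_cong n (concat C @ (a @ c @ [x]))
      (concat (map (\<lambda>i. C ! i @ [a ! i]) [0..<length C]) @ (c @ [x]))" by simp
  also have "map (\<lambda>i. C ! i @ [a ! i]) [0..<length C] = map (\<lambda>i. (C @ [c]) ! i @ [r ! i]) [0..<length C]"
    using r by (auto simp: nth_append)
  finally show ?case using r by (simp add: nth_append)
qed

text \<open>Entries of a new row that lie over existing columns extend these; the remaining ones
  form new columns of one letter each.\<close>

lemma knuth_columns:
  assumes "tableau Y" "set (concat Y) \<subseteq> {1..n}"
  shows "knuth_cong n (concat (rev Y)) (concat (columns Y))"
  using assms
proof (induction Y)
  case Nil
  then show ?case by (auto intro!: knuth_refl simp: columns_def)
next
  case (Cons r Y)
  let ?C = "columns Y"
  let ?k = "length ?C"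
  have k: "?k \<le> length r" using Cons.prems by (auto simp: columns_def dominates_def)
  have col: "column Y i = (if i < ?k then ?C ! i else [])" for i
    using Cons.prems column_beyond[of Y i] by (auto simp: columns_def)
  have "\<forall>i<?k. sorted_wrt (>) (column Y i @ [r ! i])"
    using column_decreasing[of Y] column_greater[of r Y] Cons.prems by (auto simp: sorted_wrt_append)
  then have *: "sorted_wrt (>) (?C ! i @ [r ! i])" if "i < ?k" for i using that col[of i] by auto
  have C: "set (concat ?C) \<subseteq> {1..n}"
    using columns_col[of Y n] Cons.prems by (auto simp: col_def)
  have "knuth_cong n (concat (rev Y) @ r) (concat ?C @ r)"
    using Cons by (intro polygraph_cong.app knuth_refl Cons.IH) auto
  also have "knuth_cong n ((concat ?C @ take ?k r) @ drop ?k r)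
      (concat (map (\<lambda>i. ?C ! i @ [take ?k r ! i]) [0..<?k]) @ drop ?k r)"
    using k C Cons.prems * set_take_subset[of ?k r] set_drop_subset[of ?k r]
    by (intro polygraph_cong.app knuth_refl knuth_add_row) (auto intro: sorted_wrt_take)
  then have "knuth_cong n (concat ?C @ r)
      (concat (map (\<lambda>i. ?C ! i @ [take ?k r ! i]) [0..<?k]) @ drop ?k r)" by simp
  also have "map (\<lambda>i. ?C ! i @ [take ?k r ! i]) [0..<?k] = map (column (r # Y)) [0..<?k]"
    using k col by auto
  also have "drop ?k r = concat (map (column (r # Y)) [?k..<length r])"
  proof -
    have "concat (map (column (r # Y)) [?k..<length r]) = concat (map (\<lambda>i. [r ! i]) [?k..<length r])"
      using col by (intro arg_cong[of _ _ concat] map_cong) auto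
    also have "\<dots> = map ((!) r) [?k..<length r]"
      by (induction "[?k..<length r]") auto
    also have "\<dots> = drop ?k r"
      by (simp add: list_eq_iff_nth_eq)
    finally show ?thesis by simp
  qed
  also have "concat (map (column (r # Y)) [0..<?k]) @ concat (map (column (r # Y)) [?k..<length r]) =
      concat (columns (r # Y))"
    using k upt_add_eq_append[of 0 ?k "length r - ?k"]
    by (simp add: columns_def flip: concat_append map_append)
  finally show ?case by simp
qed

lemma tab_cols_props:
  assumes "set w \<subseteq> {1..n}"
  shows "knuth_cong n w (concat (tab_cols w))" "tab_cols w \<in> lists (col n)"
    "successively forms_tableau (tab_cols w)"
proof -
  have Y: "tableau (schensted w)" "set (concat (schensted w)) \<subseteq> {1..n}"
    using tableau_schensted set_schensted[of w] assms by auto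
  show "knuth_cong n w (concat (tab_cols w))"
    unfolding tab_cols_eq using knuth_trans[OF knuth_schensted[OF assms] knuth_columns[OF Y]] .
  show "tab_cols w \<in> lists (col n)" unfolding tab_cols_eq using columns_col[OF Y] .
  show "successively forms_tableau (tab_cols w)" unfolding tab_cols_eq using successively_columns[OF Y(1)] .
qed

lemma tab_col_nth: "tab_col w i = (if i < length (tab_cols w) then tab_cols w ! i else [])"
  using column_beyond[OF tableau_schensted[of w], of i]
  by (cases "schensted w = []") (auto simp: tab_cols_eq tab_col_eq columns_def)


section \<open>Coherence\<close>

context pitman_polygraph
begin

text \<open>Split \<open>x\<close> into letters, apply the Knuth equivalence with the tableau, and
  regroup into its columns.\<close>

lemma tab_cols_cong:
  assumes "x \<in> lists (col n)"
  shows "polygraph_cong S x (tab_cols (concat x))"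
proof -
  have x: "set (concat x) \<subseteq> {1..n}" using assms by (auto simp: col_def)
  note t = tab_cols_props[OF x]
  show ?thesis
    using polygraph_cong.trans[OF polygraph_cong.sym[OF letters_concat[OF assms]]
        polygraph_cong.trans[OF knuth_letters[OF t(1)] letters_concat[OF t(2)]]] .
qed

text \<open>Both words are irreducible and congruent to \<open>x\<close>, so uniqueness of normal
  forms applies.\<close>

lemma tab_cols_eqI:
  assumes "polygraph_cong S x z" "z \<in> lists (col n)" "successively forms_tableau z"
  shows "tab_cols (concat x) = z"
proof -
  have x: "x \<in> lists (col n)" using polygraph_cong_words[OF polygraph2 assms(1)] by (simp add: gens1)
  then have "set (concat x) \<subseteq> {1..n}" by (auto simp: col_def)
  note t = tab_cols_props[OF this]
  show ?thesis
    using polygraph_cong.trans[OF polygraph_cong.sym[OF tab_cols_cong[OF x]] assms(1)]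
      successively_irreducible[OF t(2,3)] successively_irreducible[OF assms(2,3)]
    by (rule irreducible_word_unique)
qed

end

lemma forms_tableau_Nil_left: "forms_tableau [] v \<longleftrightarrow> v = []"
  by (auto simp: forms_tableau_def)

lemma concat_col_word [simp]: "concat (col_word u) = u"
  by (simp add: col_word_def)

text \<open>An instance of the locale in which no Schensted insertion occurs, so that the
  computation of \<open>P(pq)\<close> is not circular.\<close>

definition pitman_polygraph31 ::
  "nat \<Rightarrow> (nat list, nat list \<times> nat list, nat list \<times> nat list \<times> nat list) polygraph31" where
  "pitman_polygraph31 n =
     \<lparr>gens1 = col n,
      gens2 = {(u, v). u \<in> col n \<and> v \<in> col n \<and> \<not> forms_tableau u v},
      src2 = (\<lambda>(u, v). [u, v]),
      tgt2 = (\<lambda>(u, v). col_word (lcol u v) @ col_word (rcol u v)),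
      gens3 = {(u, v, t). u \<in> col n \<and> v \<in> col n \<and> t \<in> col n \<and>
                \<not> forms_tableau u v \<and> \<not> forms_tableau v t},
      src3 = pitman_src,
      tgt3 = pitman_tgt\<rparr>"

lemma pitman_polygraph_exists: "pitman_polygraph (pitman_polygraph31 n) n"
  by unfold_locales (auto simp: pitman_polygraph31_def)

lemma tab_cols_pair:
  assumes "p \<in> col0 n" "q \<in> col0 n"
  shows "tab_cols (p @ q) = col_word (lcol p q) @ col_word (rcol p q)"
proof -
  interpret pitman_polygraph "pitman_polygraph31 n" n by (rule pitman_polygraph_exists)
  have "successively forms_tableau (col_word (lcol p q) @ col_word (rcol p q))"
    using forms_tableau_lcol_rcol[OF assms] by (simp add: col_word_def)
  then have "tab_cols (concat (col_word p @ col_word q)) = col_word (lcol p q) @ col_word (rcol p q)"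
    using assms col_wordI[OF lcol_col0[OF assms]] col_wordI[OF rcol_col0[OF assms]]
    by (intro tab_cols_eqI alpha_cong) auto
  then show ?thesis by simp
qed

text \<open>An empty left column forces an empty right one, so omitting empty columns from the word
  does not shift the indices.\<close>

lemma left_right_col:
  assumes "p \<in> col0 n" "q \<in> col0 n"
  shows "left_col (p @ q) = lcol p q" "right_col (p @ q) = rcol p q"
  using forms_tableau_lcol_rcol[OF assms]
  by (auto simp: tab_col_nth tab_cols_pair[OF assms] col_word_def forms_tableau_Nil_left)

lemma X_src_tgt_eq_pitman:
  assumes "u \<in> col0 n" "v \<in> col0 n" "t \<in> col0 n"
  shows "X_src (u, v, t) = pitman_src (u, v, t)" "X_tgt (u, v, t) = pitman_tgt (u, v, t)"
  unfolding X_src_def X_tgt_def pitman_src_def pitman_tgt_def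
  using assms by (simp_all add: left_right_col[of _ n] Let_def del: One_nat_def)

lemma Col3_simps [simp]:
  "gens1 (Col3 n) = col n"
  "gens2 (Col3 n) = {(u, v). u \<in> col n \<and> v \<in> col n \<and> \<not> forms_tableau u v}"
  "src2 (Col3 n) = (\<lambda>(u, v). [u, v])"
  "tgt2 (Col3 n) = (\<lambda>(u, v). col_word (left_col (u @ v)) @ col_word (right_col (u @ v)))"
  "gens3 (Col3 n) = {(u, v, t). u \<in> col n \<and> v \<in> col n \<and> t \<in> col n \<and>
    \<not> forms_tableau u v \<and> \<not> forms_tableau v t}"
  "src3 (Col3 n) = X_src"
  "tgt3 (Col3 n) = X_tgt"
  by (simp_all add: Col3_def Col2_def polygraph2.defs)

lemma pitman_polygraph_Col3: "pitman_polygraph (Col3 n) n"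
  by unfold_locales (auto simp: col_iff left_right_col[of _ n] X_src_tgt_eq_pitman[of _ n] simp del: One_nat_def)

text \<open>A relation replaces \<open>uv\<close> by the columns of its tableau, whose reading is
  Knuth equivalent to \<open>uv\<close>.\<close>

lemma knuth_relations_Col3:
  assumes "polygraph_cong (Col3 n) x y"
  shows "knuth_cong n (concat x) (concat y)"
  using assms
proof (induction rule: polygraph_cong.induct)
  case (gen \<alpha>)
  then obtain u v where uv: "\<alpha> = (u, v)" "u \<in> col0 n" "v \<in> col0 n" by (auto simp: col_iff)
  then have "set (u @ v) \<subseteq> {1..n}" by (auto simp: col0_def)
  from tab_cols_props(1)[OF this] show ?case
    using uv by (simp add: tab_cols_pair[OF uv(2,3)] left_right_col[OF uv(2,3)] del: One_nat_def)
next
  case (refl x)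
  then show ?case by (intro knuth_refl) (auto simp: col_def)
next
  case (sym x y) then show ?case by (blast intro: polygraph_cong.sym)
next
  case (trans x y z) then show ?case by (blast intro: polygraph_cong.trans)
next
  case (app x y x' y') then show ?case by (auto intro: polygraph_cong.app)
qed

text \<open>Reading columns as words and letters as one-letter columns are inverse to each other up
  to congruence.\<close>

lemma presents_Col3: "presents (Col3 n) (plactic n)"
proof -
  interpret pitman_polygraph "Col3 n" n by (rule pitman_polygraph_Col3)
  have "presented_monoid (Col3 n) \<cong> presented_monoid (knuth_polygraph n)"
  proof (rule presented_monoid_iso[where \<phi> = concat and \<psi> = "map (\<lambda>x. [x])"])
    show "concat x \<in> lists (gens1 (knuth_polygraph n))" if "x \<in> lists (gens1 (Col3 n))" for x
      using that by (fastforce simp: knuth_polygraph_def col_def)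
    show "polygraph_cong (Col3 n) (map (\<lambda>x. [x]) (concat x)) x" if "x \<in> lists (gens1 (Col3 n))" for x
      using that by (intro letters_concat) simp
    show "knuth_cong n (concat (map (\<lambda>x. [x]) y)) y" if "y \<in> lists (gens1 (knuth_polygraph n))" for y
    proof -
      have "set y \<subseteq> {1..n}" using that by (auto simp: knuth_polygraph_def)
      then show ?thesis using knuth_refl by simp
    qed
  qed (auto intro: polygraph2 polygraph2_knuth knuth_relations_Col3 knuth_letters)
  then show ?thesis using polygraph2 by (simp add: presents_def plactic_def)
qed

text \<open>The second conjunct justifies the choice of \<open>d\<close> in the 3-cells: their
  common target is determined by \<open>P(uvt)\<close>.\<close>

theorem theorem3p2p2:
  fixes n :: nat
  assumes "n > 0"
  shows "coherent_presentation (Col3 n) (plactic n) \<and>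
    (\<forall>(u, v, t) \<in> gens3 (Col3 n).
       let a = left_col (u @ left_col (v @ t));
           d = tab_col (u @ v @ t) 1;
           b' = right_col (right_col (u @ v) @ t);
           z = col_word a @ col_word d @ col_word b'
       in z = tab_cols (u @ v @ t) \<and>
          hom2 (Col3 n) (X_src (u, v, t)) [u, v, t] z \<and>
          hom2 (Col3 n) (X_tgt (u, v, t)) [u, v, t] z)"
proof
  interpret pitman_polygraph "Col3 n" n by (rule pitman_polygraph_Col3)
  show "coherent_presentation (Col3 n) (plactic n)"
    unfolding coherent_presentation_def
    using polygraph31 presents_Col3 parallel_cells_equivalent by blast
  show "\<forall>(u, v, t) \<in> gens3 (Col3 n).
       let a = left_col (u @ left_col (v @ t));
           d = tab_col (u @ v @ t) 1;
           b' = right_col (right_col (u @ v) @ t);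
           z = col_word a @ col_word d @ col_word b'
       in z = tab_cols (u @ v @ t) \<and>
          hom2 (Col3 n) (X_src (u, v, t)) [u, v, t] z \<and>
          hom2 (Col3 n) (X_tgt (u, v, t)) [u, v, t] z"
  proof clarify
    fix u v t assume "(u, v, t) \<in> gens3 (Col3 n)"
    then have uvt: "u \<in> col0 n" "v \<in> col0 n" "t \<in> col0 n" "u \<noteq> []" "v \<noteq> []" "t \<noteq> []"
      by (auto simp: col_iff)
    define a where "a = lcol u (lcol v t)"
    define d where "d = rcol (lcol u v) (lcol (rcol u v) t)"
    define b' where "b' = rcol (rcol u v) t"
    let ?z = "col_word a @ col_word d @ col_word b'"
    have hom: "hom2 (Col3 n) (X_src (u, v, t)) [u, v, t] ?z" "hom2 (Col3 n) (X_tgt (u, v, t)) [u, v, t] ?z"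
      using pitman_cells[OF uvt(1-3)] uvt(4-) X_src_tgt_eq_pitman[OF uvt(1-3)]
      by (simp_all add: a_def d_def b'_def col_word_def[of u] col_word_def[of v] col_word_def[of t])
    \<comment> \<open>Adjacent columns of the target are the results of one transform:
      \<open>a\<close>, \<open>d\<close> on one side of the braid relation and \<open>d\<close>,
      \<open>b'\<close> on the other.\<close>
    have "forms_tableau a d"
      using forms_tableau_lcol_rcol[of "lcol u v" n "lcol (rcol u v) t"] uvt
      by (simp add: a_def d_def lcol_braid[of _ n])
    moreover have db: "forms_tableau d b'"
      using forms_tableau_lcol_rcol[of "rcol u (lcol v t)" n "rcol v t"] uvt
      by (simp add: d_def b'_def rcol_braid[of _ n] middle_braid[of _ n])
    ultimately have "successively forms_tableau ?z"
      by (auto simp: col_word_def forms_tableau_Nil_left)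
    moreover have "?z \<in> lists (col n)"
      using uvt(1-3) by (simp add: a_def d_def b'_def col_wordI del: in_lists_conv_set)
    ultimately have z: "tab_cols (u @ v @ t) = ?z"
      using tab_cols_eqI[OF hom2_imp_polygraph_cong[OF hom(1)]] by simp
    \<comment> \<open>Empty columns are omitted from the word, so \<open>a\<close> must be present
      for index 1 to point at \<open>d\<close>. If \<open>d\<close> is empty, so is
      \<open>b'\<close>.\<close>
    have "a \<noteq> []"
      using length_lcol_rcol(1)[of u n "lcol v t"] uvt forms_tableau_lcol_rcol[of u n "lcol v t"]
      by (auto simp: a_def forms_tableau_Nil_left)
    with z db have "tab_col (u @ v @ t) 1 = d"
      by (auto simp: tab_col_nth col_word_def forms_tableau_Nil_left)
    then show "let a = left_col (u @ left_col (v @ t));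
           d = tab_col (u @ v @ t) 1;
           b' = right_col (right_col (u @ v) @ t);
           z = col_word a @ col_word d @ col_word b'
       in z = tab_cols (u @ v @ t) \<and>
          hom2 (Col3 n) (X_src (u, v, t)) [u, v, t] z \<and>
          hom2 (Col3 n) (X_tgt (u, v, t)) [u, v, t] z"
      using z hom uvt by (simp add: Let_def left_right_col[of _ n] a_def b'_def del: One_nat_def)
  qed
qed

end
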